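(* Let $R\subset\mathbb{R}^N$ be a (normalized) root system with reflection group $G$ and positive subsystem $R_+$, let $k\ge0$ be a non-negative multiplicity function on $R$, and let $E_k$ be the associated Dunkl kernel. Let $H=\{z\in\mathbb{C}:\operatorname{Re}z\ge0\}$, and let $v_e$ be the asymptotic constant of $E_k$ belonging to the unit element $e\in G$. Let $x,y\in C$. Then $$\lim_{z\to\infty,\ z\in H}z^\gamma e^{-z\langle x,y\rangle}E_k(zx,y)=\frac{i^\gamma v_e}{\sqrt{w_k(x)w_k(y)}},$$ where $z^\gamma$ is the holomorphic branch in $\mathbb{C}\setminus\{x\in\mathbb{R}:x\le0\}$ with $1^\gamma=1$.
   Context: A root system is a finite set $R\subset\mathbb{R}^N\setminus\{0\}$ with $R\cap\mathbb{R}\alpha=\{\pm\alpha\}$ and $\sigma_\alpha(R)=R$ for all $\alpha\in R$, where $\sigma_\alpha$ is the reflection in the hyperplane orthogonal to $\alpha$; it is normalized so that $\langle\alpha,\alpha\rangle=2$ for all $\alpha\in R$. $\langle\cdot,\cdot\rangle$ denotes the standard Euclidean scalar product and also its bilinear extension to $\mathbb{C}^N\times\mathbb{C}^N$. $G$ is the (finite) group generated by $\{\sigma_\alpha:\alpha\in R\}$, and $R_+$ is a fixed positive subsystem ($R=R_+\cup(-R_+)$ disjointly, the two parts separated by a hyperplane through the origin). A multiplicity function is a $G$-invariant function $k:R\to\mathbb{C}$; $k\ge 0$ means $k(\alpha)\ge0$ for all $\alpha$. For $\xi\in\mathbb{R}^N$ the Dunkl operator is $$T_\xi f(x)=\partial_\xi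 f(x)+\sum_{\alpha\in R_+}k(\alpha)\langle\alpha,\xi\rangle\frac{f(x)-f(\sigma_\alpha x)}{\langle\alpha,x\rangle}.$$ The Dunkl kernel $E_k$ ($k\geq 0$) is the holomorphic function on $\mathbb{C}^N\times\mathbb{C}^N$ such that for each $y\in\mathbb{C}^N$, $f=E_k(\cdot,y)$ is the unique real-analytic solution on $\mathbb{R}^N$ of $T_\xi f=\langle\xi,y\rangle f$ for all $\xi\in\mathbb{R}^N$, $f(0)=1$. $w_k(x)=\prod_{\alpha\in R_+}|\langle\alpha,x\rangle|^{2k(\alpha)}$ and $\gamma=\sum_{\alpha\in R_+}k(\alpha)$. $C=\{x\in\mathbb{R}^N:\langle\alpha,x\rangle>0\ \text{for all }\alpha\in R_+\}$, and $C_\delta=\{x\in C:\langle\alpha,x\rangle>\delta|x|\ \text{for all }\alpha\in R_+\}$ for $\delta>0$. The constant $v_e\in\mathbb{C}$ is the (existing) number such that for all $y\in C$ and $\delta>0$: $\lim_{|x|\to\infty,\,x\in C_\delta}\sqrt{w_k(x)w_k(y)}\,e^{-i\langle x,y\rangle}E_k(ix,y)=v_e$. *)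

theory Defs
  imports "HOL-Analysis.Analysis"
begin

section \<open>Root systems\<close>

definition refl :: "real ^ 'n \<Rightarrow> real ^ 'n \<Rightarrow> real ^ 'n" where
  "refl \<alpha> x = x - (2 * (\<alpha> \<bullet> x) / (\<alpha> \<bullet> \<alpha>)) *\<^sub>R \<alpha>"

definition normalized_root_system :: "(real ^ 'n) set \<Rightarrow> bool" where
  "normalized_root_system R \<longleftrightarrow>
     finite R \<and> 0 \<notin> R \<and>
     (\<forall>\<alpha>\<in>R. R \<inter> range (\<lambda>t. t *\<^sub>R \<alpha>) = {\<alpha>, - \<alpha>}) \<and>
     (\<forall>\<alpha>\<in>R. refl \<alpha> ` R = R) \<and>
     (\<forall>\<alpha>\<in>R. \<alpha> \<bullet> \<alpha> = 2)"

inductive_set reflection_group :: "(real ^ 'n) set \<Rightarrow> (real ^ 'n \<Rightarrow> real ^ 'n) set"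
  for R :: "(real ^ 'n) set" where
  one: "id \<in> reflection_group R"
| gen: "\<alpha> \<in> R \<Longrightarrow> refl \<alpha> \<in> reflection_group R"
| comp: "g \<in> reflection_group R \<Longrightarrow> h \<in> reflection_group R \<Longrightarrow> g \<circ> h \<in> reflection_group R"
| inverse: "g \<in> reflection_group R \<Longrightarrow> inv g \<in> reflection_group R"

definition positive_subsystem :: "(real ^ 'n) set \<Rightarrow> (real ^ 'n) set \<Rightarrow> bool" where
  "positive_subsystem R Rp \<longleftrightarrow>
     R = Rp \<union> uminus ` Rp \<and> Rp \<inter> uminus ` Rp = {} \<and>
     (\<exists>\<beta>. \<forall>\<alpha>\<in>Rp. 0 < \<beta> \<bullet> \<alpha>)"

text \<open>Only non-negative multiplicities occur, so they are taken real-valued; values of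
  \<open>k\<close> outside \<open>R\<close> are irrelevant.\<close>

definition nonneg_multiplicity :: "(real ^ 'n) set \<Rightarrow> (real ^ 'n \<Rightarrow> real) \<Rightarrow> bool" where
  "nonneg_multiplicity R k \<longleftrightarrow>
     (\<forall>g\<in>reflection_group R. \<forall>\<alpha>\<in>R. k (g \<alpha>) = k \<alpha>) \<and> (\<forall>\<alpha>\<in>R. 0 \<le> k \<alpha>)"

text \<open>Since \<open>0 powr 0 = 0\<close>, the weight deviates from the usual convention on the reflecting
  hyperplanes; it is only evaluated inside the open chamber.\<close>

definition weight :: "(real ^ 'n) set \<Rightarrow> (real ^ 'n \<Rightarrow> real) \<Rightarrow> real ^ 'n \<Rightarrow> real" where
  "weight Rp k x = (\<Prod>\<alpha>\<in>Rp. \<bar>\<alpha> \<bullet> x\<bar> powr (2 * k \<alpha>))"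

definition gamma_index :: "(real ^ 'n) set \<Rightarrow> (real ^ 'n \<Rightarrow> real) \<Rightarrow> real" where
  "gamma_index Rp k = (\<Sum>\<alpha>\<in>Rp. k \<alpha>)"

definition chamber :: "(real ^ 'n) set \<Rightarrow> (real ^ 'n) set" where
  "chamber Rp = {x. \<forall>\<alpha>\<in>Rp. 0 < \<alpha> \<bullet> x}"

definition chamber_cone :: "(real ^ 'n) set \<Rightarrow> real \<Rightarrow> (real ^ 'n) set" where
  "chamber_cone Rp \<delta> = {x \<in> chamber Rp. \<forall>\<alpha>\<in>Rp. \<delta> * norm x < \<alpha> \<bullet> x}"

section \<open>Dunkl operators and the Dunkl kernel\<close>

definition cvec :: "real ^ 'n \<Rightarrow> complex ^ 'n" where
  "cvec x = (\<chi> i. complex_of_real (x $ i))"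

text \<open>The complex-bilinear (not Hermitian) extension of the Euclidean scalar product.\<close>

definition cdot :: "complex ^ 'n \<Rightarrow> complex ^ 'n \<Rightarrow> complex" where
  "cdot u v = (\<Sum>i\<in>UNIV. u $ i * v $ i)"

text \<open>The difference quotient in the Dunkl operator is extended continuously across the
  hyperplane orthogonal to \<open>\<alpha>\<close>. When \<open>\<alpha> \<bullet> \<alpha> = 2\<close> one has \<open>refl \<alpha> x = x - (\<alpha> \<bullet> x) *\<^sub>R \<alpha>\<close>,
  so for continuously differentiable \<open>f\<close> the limiting value is the derivative of \<open>f\<close> in
  direction \<open>\<alpha>\<close>.\<close>

definition dunkl_quotient :: "real ^ 'n \<Rightarrow> (real ^ 'n \<Rightarrow> complex) \<Rightarrow> real ^ 'n \<Rightarrow> complex" where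
  "dunkl_quotient \<alpha> f x =
     (if \<alpha> \<bullet> x = 0 then frechet_derivative f (at x) \<alpha>
      else (f x - f (refl \<alpha> x)) / complex_of_real (\<alpha> \<bullet> x))"

definition dunkl_operator ::
  "(real ^ 'n) set \<Rightarrow> (real ^ 'n \<Rightarrow> real) \<Rightarrow> real ^ 'n \<Rightarrow> (real ^ 'n \<Rightarrow> complex) \<Rightarrow> real ^ 'n \<Rightarrow> complex"
where
  "dunkl_operator Rp k \<xi> f x =
     frechet_derivative f (at x) \<xi> +
     (\<Sum>\<alpha>\<in>Rp. complex_of_real (k \<alpha>) * complex_of_real (\<alpha> \<bullet> \<xi>) * dunkl_quotient \<alpha> f x)"

text \<open>Local expansion into an unconditionally convergent power series at every point; the
  multi-indices are the functions \<open>'n \<Rightarrow> nat\<close>.\<close>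

definition real_analytic :: "(real ^ 'n \<Rightarrow> complex) \<Rightarrow> bool" where
  "real_analytic f \<longleftrightarrow>
     (\<forall>a. \<exists>c :: ('n \<Rightarrow> nat) \<Rightarrow> complex. \<exists>r>0. \<forall>x. (\<forall>i. \<bar>x $ i - a $ i\<bar> < r) \<longrightarrow>
        ((\<lambda>m. c m * complex_of_real (\<Prod>i\<in>UNIV. (x $ i - a $ i) ^ m i)) has_sum f x) UNIV)"

text \<open>Holomorphy in several variables: total differentiability with complex-linear derivative.\<close>

definition holomorphic2 :: "(complex ^ 'n \<Rightarrow> complex ^ 'n \<Rightarrow> complex) \<Rightarrow> bool" where
  "holomorphic2 E \<longleftrightarrow>
     (\<forall>p. \<exists>D. ((\<lambda>(x, y). E x y) has_derivative D) (at p) \<and>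
          (\<forall>c u v. D (c *s u, c *s v) = c * D (u, v)))"

definition dunkl_eigenfunction ::
  "(real ^ 'n) set \<Rightarrow> (real ^ 'n \<Rightarrow> real) \<Rightarrow> complex ^ 'n \<Rightarrow> (real ^ 'n \<Rightarrow> complex) \<Rightarrow> bool" where
  "dunkl_eigenfunction Rp k y f \<longleftrightarrow>
     real_analytic f \<and> f 0 = 1 \<and>
     (\<forall>\<xi> x. dunkl_operator Rp k \<xi> f x = cdot (cvec \<xi>) y * f x)"

text \<open>A predicate instead of a definite description: \<open>E\<close> has the properties that characterize
  the Dunkl kernel. Holomorphic functions on \<open>\<complex>\<^sup>N \<times> \<complex>\<^sup>N\<close> are determined by their values at
  real first arguments, so at most one \<open>E\<close> satisfies it.\<close>

definition is_dunkl_kernel ::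
  "(real ^ 'n) set \<Rightarrow> (real ^ 'n \<Rightarrow> real) \<Rightarrow> (complex ^ 'n \<Rightarrow> complex ^ 'n \<Rightarrow> complex) \<Rightarrow> bool" where
  "is_dunkl_kernel Rp k E \<longleftrightarrow>
     holomorphic2 E \<and>
     (\<forall>y. dunkl_eigenfunction Rp k y (\<lambda>x. E (cvec x) y) \<and>
          (\<forall>f. dunkl_eigenfunction Rp k y f \<longrightarrow> f = (\<lambda>x. E (cvec x) y)))"

text \<open>The defining property of the asymptotic constant belonging to the unit element of the
  reflection group.\<close>

definition is_asymptotic_constant ::
  "(real ^ 'n) set \<Rightarrow> (real ^ 'n \<Rightarrow> real) \<Rightarrow> (complex ^ 'n \<Rightarrow> complex ^ 'n \<Rightarrow> complex) \<Rightarrow> complex \<Rightarrow> bool"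
where
  "is_asymptotic_constant Rp k E v \<longleftrightarrow>
     (\<forall>y\<in>chamber Rp. \<forall>\<delta>>0.
        ((\<lambda>x. complex_of_real (sqrt (weight Rp k x * weight Rp k y)) *
               exp (- \<i> * complex_of_real (x \<bullet> y)) * E (\<i> *s cvec x) (cvec y))
           \<longlongrightarrow> v) (inf at_infinity (principal (chamber_cone Rp \<delta>))))"

end

theory Submission
  imports Defs "HOL-Complex_Analysis.Conformal_Mappings" "HOL-Real_Asymp.Real_Asymp"
begin

text \<open>
  Write \<open>\<phi>\<^sub>p(z) = E(z p, y)\<close>, \<open>\<lambda> = \<langle>x, y\<rangle>\<close> and \<open>F(z) = z\<^sup>\<gamma> exp(-\<lambda>z) \<phi>\<^sub>x(z)\<close>. The defining property of
  the asymptotic constant, applied along the ray through \<open>x\<close>, gives the limit of \<open>F\<close> on the positive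
  imaginary axis, because \<open>w\<^sub>k\<close> is homogeneous of degree \<open>2\<gamma>\<close>. What remains is to carry this limit
  into the whole half plane, which is a question about the growth of \<open>F\<close> there.

  The growth is controlled by a maximum principle. Inserting \<open>\<xi> = t p\<close> into the eigenvalue equations
  at the point \<open>t p\<close> removes the denominators of the Dunkl operator and leaves a system of ordinary
  differential equations that couples \<open>\<phi>\<^sub>p\<close> only to the functions at the reflected points
  (\<open>ray_equation\<close>):
  \<open>z \<phi>\<^sub>p'(z) = z \<langle>p, y\<rangle> \<phi>\<^sub>p(z) - (\<Sum>\<alpha>. k(\<alpha>) (\<phi>\<^sub>p(z) - \<phi>\<^sub>q(z)))\<close> with \<open>q = \<sigma>\<^sub>\<alpha> p\<close>.
  At a point \<open>p\<close> of the orbit of \<open>x\<close> where \<open>|\<phi>\<^sub>p(z)|\<close> is largest, the sum slows the growth down, as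
  \<open>k \<ge> 0\<close>; hence the maximum grows along rays at most at the rate \<open>Re z \<cdot> max \<langle>p, y\<rangle>\<close>. For \<open>x\<close> and
  \<open>y\<close> in the same chamber the maximum of \<open>\<langle>p, y\<rangle>\<close> over the orbit is \<open>\<lambda>\<close>
  (\<open>positive_roots.word_inner_le\<close>), so
  \<open>|\<phi>\<^sub>x(z)| \<le> exp(\<lambda> Re z)\<close> for \<open>Re z \<ge> 0\<close> (\<open>positive_roots.ray_bound\<close>) and \<open>F\<close> grows at most
  polynomially in the half plane.

  The rest is complex analysis in the style of Phragmen, Lindelof and Montel
  (\<open>symmetric_half_plane_tendsto\<close>). As \<open>\<phi>\<^sub>x\<close> is real on the real line, \<open>F\<close> has limits \<open>a\<close> and
  \<open>cnj a\<close> at the two ends of the imaginary axis, and so it is bounded in the half plane. The function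
  \<open>(F - a) (F - cnj a)\<close> tends to \<open>0\<close> at both ends, therefore in the whole half plane; on the positive
  reals, where \<open>F\<close> is real, it equals \<open>|F - a|\<^sup>2\<close>. Thus \<open>F\<close> tends to \<open>a\<close> there, which forces \<open>a\<close> to
  be real, and then \<open>(F - a)\<^sup>2\<close> tends to \<open>0\<close> throughout the half plane.
\<close>

section \<open>Reflections, simple roots and the orbit of a chamber point\<close>

lemma linear_refl: "linear (refl \<alpha>)"
  by (rule linearI) (simp_all add: refl_def inner_add_right algebra_simps add_divide_distrib)

lemma inner_refl_refl [simp]: "refl \<alpha> p \<bullet> refl \<alpha> q = p \<bullet> q"
  by (cases "\<alpha> = 0") (simp_all add: refl_def inner_diff_left inner_diff_right inner_commute field_simps)

lemma refl_refl [simp]: "refl \<alpha> (refl \<alpha> p) = p"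
  by (cases "\<alpha> = 0") (simp_all add: refl_def inner_diff_right algebra_simps)

lemma inner_refl_swap: "p \<bullet> refl \<alpha> q = refl \<alpha> p \<bullet> q"
  using inner_refl_refl[of \<alpha> "refl \<alpha> p" q] by simp

lemma norm_refl [simp]: "norm (refl \<alpha> p) = norm p"
  by (simp add: norm_eq_sqrt_inner)

lemma refl_minus: "refl (- \<alpha>) = refl \<alpha>"
  by (rule ext) (simp add: refl_def)

lemma refl_conjugate: "refl (refl \<gamma> \<alpha>) (refl \<gamma> p) = refl \<gamma> (refl \<alpha> p)"
proof -
  have "refl \<gamma> (refl \<alpha> p) = refl \<gamma> p - (2 * (\<alpha> \<bullet> p) / (\<alpha> \<bullet> \<alpha>)) *\<^sub>R refl \<gamma> \<alpha>"
    by (simp add: refl_def[of \<alpha>] linear_diff[OF linear_refl] linear_scale[OF linear_refl])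
  then show ?thesis by (simp add: refl_def[of "refl \<gamma> \<alpha>"])
qed

locale positive_roots =
  fixes Rp :: "(real ^ 'n) set"
  assumes finite_roots: "finite Rp"
    and root_norm: "\<alpha> \<in> Rp \<Longrightarrow> \<alpha> \<bullet> \<alpha> = 2"
    and refl_root: "\<alpha> \<in> Rp \<Longrightarrow> \<beta> \<in> Rp \<Longrightarrow> refl \<alpha> \<beta> \<in> Rp \<or> - refl \<alpha> \<beta> \<in> Rp"
begin

text \<open>These are the simple roots in the usual sense. They are characterized here by
  the property on which the exchange argument rests, and not as indecomposable positive roots.\<close>

definition simple_roots :: "(real ^ 'n) set" where
  "simple_roots = {\<beta> \<in> Rp. \<forall>\<alpha>\<in>Rp. \<alpha> \<noteq> \<beta> \<longrightarrow> refl \<beta> \<alpha> \<in> Rp}"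

lemma refl_by_root: "\<alpha> \<in> Rp \<Longrightarrow> refl \<alpha> p = p - (\<alpha> \<bullet> p) *\<^sub>R \<alpha>"
  by (simp add: refl_def root_norm)

lemma inner_roots_less:
  assumes "\<alpha> \<in> Rp" "\<beta> \<in> Rp" "\<alpha> \<noteq> \<beta>"
  shows "\<alpha> \<bullet> \<beta> < 2"
proof -
  have "0 < (\<alpha> - \<beta>) \<bullet> (\<alpha> - \<beta>)" using assms by simp
  also have "\<dots> = 4 - 2 * (\<alpha> \<bullet> \<beta>)"
    using assms by (simp add: inner_diff_left inner_diff_right root_norm inner_commute)
  finally show ?thesis by simp
qed

lemma chamber_inner_pos: "y \<in> chamber Rp \<Longrightarrow> \<alpha> \<in> Rp \<Longrightarrow> 0 < \<alpha> \<bullet> y"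
  by (simp add: chamber_def)

text \<open>A non-simple \<open>\<alpha>\<close> sends some positive \<open>\<gamma>\<close> to a negative root \<open>-\<delta>\<close>, and then
  \<open>\<gamma> + \<delta> = \<langle>\<alpha>, \<gamma>\<rangle> \<alpha>\<close> with \<open>\<langle>\<alpha>, \<gamma>\<rangle> < 2\<close>. Measured by \<open>y\<close>, the heights of \<open>\<gamma>\<close> and \<open>\<delta>\<close> add up to less
  than twice the height of \<open>\<alpha>\<close>, so one of the two lies strictly below \<open>\<alpha>\<close>.\<close>

lemma nonsimple_root_lower:
  assumes y: "y \<in> chamber Rp" and \<alpha>: "\<alpha> \<in> Rp" "\<alpha> \<notin> simple_roots"
  obtains \<gamma> where "\<gamma> \<in> Rp" "0 < \<alpha> \<bullet> \<gamma>" "\<alpha> \<bullet> \<gamma> < 2" "\<gamma> \<bullet> y < \<alpha> \<bullet> y"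
proof -
  obtain \<gamma> where \<gamma>: "\<gamma> \<in> Rp" "\<gamma> \<noteq> \<alpha>" "refl \<alpha> \<gamma> \<notin> Rp"
    using \<alpha> by (auto simp: simple_roots_def)
  define \<delta> where "\<delta> = - refl \<alpha> \<gamma>"
  have \<delta>: "\<delta> \<in> Rp" using refl_root[OF \<alpha>(1) \<gamma>(1)] \<gamma>(3) by (simp add: \<delta>_def)
  have \<delta>_eq: "\<delta> = (\<alpha> \<bullet> \<gamma>) *\<^sub>R \<alpha> - \<gamma>" using \<alpha> by (simp add: \<delta>_def refl_by_root)
  have same: "\<alpha> \<bullet> \<delta> = \<alpha> \<bullet> \<gamma>" using \<alpha> by (simp add: \<delta>_eq inner_diff_right root_norm)
  have heights: "\<gamma> \<bullet> y + \<delta> \<bullet> y = (\<alpha> \<bullet> \<gamma>) * (\<alpha> \<bullet> y)"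
    by (simp add: \<delta>_eq inner_diff_left)
  have pos: "0 < \<alpha> \<bullet> y" "0 < \<gamma> \<bullet> y" "0 < \<delta> \<bullet> y"
    using y \<alpha> \<gamma> \<delta> chamber_inner_pos by auto
  have less: "\<alpha> \<bullet> \<gamma> < 2" using inner_roots_less \<alpha> \<gamma> by auto
  have "0 < (\<alpha> \<bullet> \<gamma>) * (\<alpha> \<bullet> y)" using heights pos by linarith
  then have gt: "0 < \<alpha> \<bullet> \<gamma>" using pos by (simp add: zero_less_mult_iff)
  have "(\<alpha> \<bullet> \<gamma>) * (\<alpha> \<bullet> y) < 2 * (\<alpha> \<bullet> y)" using less pos by simp
  then have "\<gamma> \<bullet> y < \<alpha> \<bullet> y \<or> \<delta> \<bullet> y < \<alpha> \<bullet> y" using heights by linarith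
  then show thesis
  proof
    assume "\<gamma> \<bullet> y < \<alpha> \<bullet> y" then show thesis using that \<gamma> gt less by blast
  next
    assume "\<delta> \<bullet> y < \<alpha> \<bullet> y" then show thesis using that[of \<delta>] \<delta> gt less same by simp
  qed
qed

text \<open>Induction on the height \<open>\<langle>\<alpha>, y\<rangle>\<close>: with a lower root \<open>\<gamma>\<close> from the previous lemma,
  \<open>\<sigma>\<^sub>\<alpha> = \<sigma>\<^sub>\<gamma> \<sigma>\<^sub>\<delta> \<sigma>\<^sub>\<gamma>\<close> for \<open>\<delta> = \<sigma>\<^sub>\<gamma> \<alpha>\<close>, and whichever of \<open>\<delta>\<close> and \<open>-\<delta>\<close> is positive again lies below \<open>\<alpha>\<close>.\<close>

lemma refl_simple_word:
  assumes y: "y \<in> chamber Rp" and "\<alpha> \<in> Rp"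
  shows "\<exists>l. set l \<subseteq> simple_roots \<and> refl \<alpha> = foldr refl l"
  using assms(2)
proof (induction "card {\<beta> \<in> Rp. \<beta> \<bullet> y < \<alpha> \<bullet> y}" arbitrary: \<alpha> rule: less_induct)
  case less
  have IH: "\<exists>l. set l \<subseteq> simple_roots \<and> refl \<beta> = foldr refl l"
    if "\<beta> \<in> Rp" "\<beta> \<bullet> y < \<alpha> \<bullet> y" for \<beta>
  proof (rule less.hyps[OF _ that(1)], rule psubset_card_mono)
    show "finite {\<beta> \<in> Rp. \<beta> \<bullet> y < \<alpha> \<bullet> y}" using finite_roots by simp
    show "{\<beta>' \<in> Rp. \<beta>' \<bullet> y < \<beta> \<bullet> y} \<subset> {\<beta> \<in> Rp. \<beta> \<bullet> y < \<alpha> \<bullet> y}"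
      using that by force
  qed
  show ?case
  proof (cases "\<alpha> \<in> simple_roots")
    case True
    then show ?thesis by (intro exI[of _ "[\<alpha>]"]) auto
  next
    case False
    then obtain \<gamma> where \<gamma>: "\<gamma> \<in> Rp" "0 < \<alpha> \<bullet> \<gamma>" "\<alpha> \<bullet> \<gamma> < 2" "\<gamma> \<bullet> y < \<alpha> \<bullet> y"
      using nonsimple_root_lower[OF y less.prems] by metis
    have pos: "0 < \<gamma> \<bullet> y" "0 < \<alpha> \<bullet> y" using \<gamma>(1) less.prems y chamber_inner_pos by auto
    have height: "refl \<gamma> \<alpha> \<bullet> y = \<alpha> \<bullet> y - (\<alpha> \<bullet> \<gamma>) * (\<gamma> \<bullet> y)"
      using \<gamma>(1) by (simp add: refl_by_root inner_diff_left inner_commute[of \<gamma> \<alpha>])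
    have p1: "0 < (\<alpha> \<bullet> \<gamma>) * (\<gamma> \<bullet> y)" using \<gamma>(2) pos by simp
    have p2: "(\<alpha> \<bullet> \<gamma>) * (\<gamma> \<bullet> y) < 2 * (\<gamma> \<bullet> y)" using \<gamma>(3) pos by simp
    have "\<exists>\<delta>. \<delta> \<in> Rp \<and> \<delta> \<bullet> y < \<alpha> \<bullet> y \<and> refl \<delta> = refl (refl \<gamma> \<alpha>)"
      using refl_root[OF \<gamma>(1) less.prems]
    proof
      assume "refl \<gamma> \<alpha> \<in> Rp"
      then show ?thesis using height p1 by (intro exI[of _ "refl \<gamma> \<alpha>"]) simp
    next
      assume "- refl \<gamma> \<alpha> \<in> Rp"
      then show ?thesis
        using height p2 \<gamma>(4) by (intro exI[of _ "- refl \<gamma> \<alpha>"]) (simp add: refl_minus)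
    qed
    then obtain m where m: "set m \<subseteq> simple_roots" "refl (refl \<gamma> \<alpha>) = foldr refl m"
      using IH by metis
    obtain l where l: "set l \<subseteq> simple_roots" "refl \<gamma> = foldr refl l"
      using IH \<gamma> by metis
    have "refl \<alpha> = refl \<gamma> \<circ> refl (refl \<gamma> \<alpha>) \<circ> refl \<gamma>"
      by (rule ext) (simp add: refl_conjugate)
    also have "\<dots> = foldr refl (l @ m @ l)" unfolding m(2) unfolding l(2) by (simp add: fun_eq_iff)
    finally show ?thesis using l(1) m(1) by (intro exI[of _ "l @ m @ l"]) auto
  qed
qed

text \<open>The exchange property. Read from the left, the word moves \<open>\<alpha>\<close> through the simple reflections; since
  \<open>\<alpha>\<close> is positive on \<open>x\<close> but negative on the image of \<open>x\<close>, it must change sign on the way, and a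
  simple reflection changes the sign of its own root only. At that letter \<open>\<sigma>\<^sub>\<alpha>\<close> cancels it.\<close>

lemma exchange:
  assumes "set l \<subseteq> simple_roots" "\<alpha> \<in> Rp" "x \<in> chamber Rp" "\<alpha> \<bullet> foldr refl l x < 0"
  shows "\<exists>m. set m \<subseteq> simple_roots \<and> length m < length l \<and> refl \<alpha> \<circ> foldr refl l = foldr refl m"
  using assms
proof (induction l arbitrary: \<alpha>)
  case Nil
  then show ?case by (auto dest: chamber_inner_pos)
next
  case (Cons \<beta> l)
  show ?case
  proof (cases "\<alpha> = \<beta>")
    case True
    then show ?thesis using Cons.prems by (intro exI[of _ l]) (auto simp: fun_eq_iff)
  next
    case False
    then have "refl \<beta> \<alpha> \<in> Rp" using Cons.prems by (auto simp: simple_roots_def)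
    moreover have "refl \<beta> \<alpha> \<bullet> foldr refl l x < 0"
      using Cons.prems(4) by (simp add: inner_refl_swap)
    ultimately have "\<exists>m. set m \<subseteq> simple_roots \<and> length m < length l \<and>
        refl (refl \<beta> \<alpha>) \<circ> foldr refl l = foldr refl m"
      using Cons.IH[of "refl \<beta> \<alpha>"] Cons.prems(1,3) by (meson set_subset_Cons subset_trans)
    then obtain m where m: "set m \<subseteq> simple_roots" "length m < length l"
      "refl (refl \<beta> \<alpha>) \<circ> foldr refl l = foldr refl m"
      by blast
    have "refl \<alpha> (refl \<beta> p) = refl \<beta> (refl (refl \<beta> \<alpha>) p)" for p
      using refl_conjugate[of \<beta> \<alpha> "refl \<beta> p"] refl_refl by metis
    then have "refl \<alpha> \<circ> foldr refl (\<beta> # l) = foldr refl (\<beta> # m)"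
      using m(3) by (auto simp: fun_eq_iff)
    moreover have "set (\<beta> # m) \<subseteq> simple_roots" "length (\<beta> # m) < length (\<beta> # l)"
      using m(1,2) Cons.prems(1) by auto
    ultimately show ?thesis by blast
  qed
qed

text \<open>Induction on the length. The first letter \<open>\<beta>\<close> either subtracts a non-negative multiple of \<open>\<beta>\<close>, which
  lowers the product with \<open>y\<close>, or the exchange property shortens the word.\<close>

lemma simple_word_inner_le:
  assumes "set l \<subseteq> simple_roots" "x \<in> chamber Rp" "y \<in> chamber Rp"
  shows "foldr refl l x \<bullet> y \<le> x \<bullet> y"
  using assms(1)
proof (induction "length l" arbitrary: l rule: less_induct)
  case less
  show ?case
  proof (cases l)
    case (Cons \<beta> m)
    have \<beta>: "\<beta> \<in> Rp" using Cons less.prems by (auto simp: simple_roots_def)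
    show ?thesis
    proof (cases "\<beta> \<bullet> foldr refl m x < 0")
      case True
      then obtain m' where "set m' \<subseteq> simple_roots" "length m' < length m"
        "refl \<beta> \<circ> foldr refl m = foldr refl m'"
        using exchange[of m \<beta> x] \<beta> assms less.prems Cons by auto
      then show ?thesis using less.hyps[of m'] Cons by (simp add: fun_eq_iff)
    next
      case False
      then have "0 \<le> (\<beta> \<bullet> foldr refl m x) * (\<beta> \<bullet> y)"
        using chamber_inner_pos[OF assms(3) \<beta>] by simp
      then have "foldr refl l x \<bullet> y \<le> foldr refl m x \<bullet> y"
        using Cons \<beta> by (simp add: refl_by_root inner_diff_left)
      also have "\<dots> \<le> x \<bullet> y" using less Cons by simp
      finally show ?thesis .
    qed
  qed simp
qed

lemma word_inner_le:
  assumes "set l \<subseteq> Rp" "x \<in> chamber Rp" "y \<in> chamber Rp"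
  shows "foldr refl l x \<bullet> y \<le> x \<bullet> y"
proof -
  have "\<exists>m. set m \<subseteq> simple_roots \<and> foldr refl l = foldr refl m"
    using assms(1)
  proof (induction l)
    case Nil
    then show ?case by (intro exI[of _ "[]"]) simp
  next
    case (Cons \<alpha> l)
    then obtain m where "set m \<subseteq> simple_roots" "foldr refl l = foldr refl m" by auto
    moreover obtain a where "set a \<subseteq> simple_roots" "refl \<alpha> = foldr refl a"
      using refl_simple_word[OF assms(3), of \<alpha>] Cons.prems by auto
    ultimately show ?case by (intro exI[of _ "a @ m"]) auto
  qed
  then show ?thesis using simple_word_inner_le assms by metis
qed

text \<open>The closure of the orbit of \<open>x\<close> is a compact domain for the maximum principle below; invariance and
  the bound on the products with \<open>y\<close> pass from the orbit to its closure by continuity.\<close>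

lemma compact_invariant_set:
  assumes x: "x \<in> chamber Rp" and y: "y \<in> chamber Rp"
  obtains S where "compact S" "x \<in> S" "\<And>\<alpha> p. \<alpha> \<in> Rp \<Longrightarrow> p \<in> S \<Longrightarrow> refl \<alpha> p \<in> S"
    "\<And>p. p \<in> S \<Longrightarrow> p \<bullet> y \<le> x \<bullet> y"
proof -
  define Orb where "Orb = (\<lambda>l. foldr refl l x) ` lists Rp"
  have nrm: "norm (foldr refl l x) = norm x" for l by (induction l) auto
  show thesis
  proof (rule that[of "closure Orb"])
    have "bounded Orb" by (auto simp: Orb_def nrm bounded_iff)
    then show "compact (closure Orb)" by simp
    have "foldr refl [] x \<in> Orb" unfolding Orb_def by (intro imageI) simp
    then show "x \<in> closure Orb" using closure_subset by auto
  next
    fix \<alpha> p assume \<alpha>: "\<alpha> \<in> Rp" and p: "p \<in> closure Orb"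
    have "refl \<alpha> ` Orb \<subseteq> Orb"
    proof clarify
      fix p assume "p \<in> Orb"
      then obtain l where "l \<in> lists Rp" "p = foldr refl l x" by (auto simp: Orb_def)
      then have "refl \<alpha> p = foldr refl (\<alpha> # l) x" "\<alpha> # l \<in> lists Rp" using \<alpha> by auto
      then show "refl \<alpha> p \<in> Orb" unfolding Orb_def by (rule image_eqI)
    qed
    moreover have "refl \<alpha> p \<in> closure (refl \<alpha> ` Orb)"
      using closure_linear_image_subset[OF linear_refl] p by blast
    ultimately show "refl \<alpha> p \<in> closure Orb" using closure_mono by blast
  next
    fix p assume p: "p \<in> closure Orb"
    have "Orb \<subseteq> {p. p \<bullet> y \<le> x \<bullet> y}"
      using word_inner_le[OF _ x y] by (auto simp: Orb_def in_lists_conv_set subset_iff)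
    moreover have "closed {p. p \<bullet> y \<le> x \<bullet> y}"
      by (intro closed_Collect_le continuous_intros)
    ultimately show "p \<bullet> y \<le> x \<bullet> y" using closure_minimal p by blast
  qed
qed

end

section \<open>The Dunkl kernel along a complex line\<close>

text \<open>The restriction of \<open>E(\<cdot>, y)\<close> to the complex line through \<open>p\<close>, an entire function of one variable.\<close>

definition ray :: "(complex ^ 'n \<Rightarrow> complex ^ 'n \<Rightarrow> complex) \<Rightarrow> real ^ 'n \<Rightarrow> real ^ 'n \<Rightarrow> complex \<Rightarrow> complex"
  where "ray E y p z = E (z *s cvec p) (cvec y)"

lemma bounded_linear_cvec: "bounded_linear cvec"
  unfolding linear_conv_bounded_linear[symmetric]
  by (rule linearI; simp add: cvec_def vec_eq_iff; simp add: scaleR_conv_of_real)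

lemma cvec_scaleR: "cvec (t *\<^sub>R p) = complex_of_real t *s cvec p"
  by (simp add: cvec_def vec_eq_iff)

lemma cdot_cvec: "cdot (cvec p) (cvec q) = complex_of_real (p \<bullet> q)"
  by (simp add: cdot_def cvec_def inner_vec_def)

lemma bounded_linear_mult_cvec: "bounded_linear (\<lambda>z. z *s cvec p)"
  unfolding linear_conv_bounded_linear[symmetric]
  by (rule linearI) (simp_all add: vec_eq_iff algebra_simps)

lemma entire_cnj_cnj:
  assumes "f holomorphic_on UNIV"
  shows "(\<lambda>z. cnj (f (cnj z))) holomorphic_on UNIV"
proof -
  have "range cnj = UNIV" by (rule surjI[of cnj cnj]) simp
  then show ?thesis using assms holomorphic_on_compose_cnj_cnj[of f UNIV] by (simp add: o_def)
qed

lemma entire_eq_on_reals: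
  assumes "f holomorphic_on UNIV" "g holomorphic_on UNIV" "\<And>t::real. f (of_real t) = g (of_real t)"
  shows "f z = g z"
proof -
  have "f z - g z = 0"
  proof (rule analytic_continuation[of "\<lambda>z. f z - g z" UNIV \<real> 0 z])
    show "(0::complex) islimpt \<real>"
      unfolding islimpt_approachable
    proof (intro allI impI)
      fix e :: real assume "0 < e"
      then show "\<exists>x'\<in>\<real>. x' \<noteq> (0::complex) \<and> dist x' 0 < e"
        by (intro bexI[of _ "of_real (e / 2)"]) auto
    qed
  qed (use assms in \<open>auto intro!: holomorphic_intros elim!: Reals_cases\<close>)
  then show ?thesis by simp
qed

lemma kernel_derivative:
  assumes "holomorphic2 E"
  obtains D where "((\<lambda>u. E u w) has_derivative D) (at u)" "\<And>c v. D (c *s v) = c * D v"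
proof -
  obtain D where D: "((\<lambda>(u, w). E u w) has_derivative D) (at (u, w))"
    and scale: "\<And>c v v'. D (c *s v, c *s v') = c * D (v, v')"
    using assms unfolding holomorphic2_def by blast
  have "((\<lambda>u. (u, w)) has_derivative (\<lambda>v. (v, 0))) (at u)"
    by (intro has_derivative_Pair has_derivative_ident has_derivative_const)
  from has_derivative_compose[OF this D]
  have "((\<lambda>u. E u w) has_derivative (\<lambda>v. D (v, 0))) (at u)" by simp
  then show thesis by (rule that) (use scale[of _ _ 0] in simp)
qed

lemma ray_has_derivative:
  assumes "((\<lambda>u. E u (cvec y)) has_derivative D) (at (z *s cvec p))" "\<And>c v. D (c *s v) = c * D v"
  shows "(ray E y p has_field_derivative D (cvec p)) (at z)"
proof -
  have "((\<lambda>z. z *s cvec p) has_derivative (\<lambda>h. h *s cvec p)) (at z)"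
    by (rule bounded_linear_imp_has_derivative[OF bounded_linear_mult_cvec])
  from has_derivative_compose[OF this assms(1)]
  have "(ray E y p has_derivative (\<lambda>h. h * D (cvec p))) (at z)"
    by (simp add: ray_def[abs_def] assms(2))
  moreover have "(\<lambda>h. h * D (cvec p)) = (*) (D (cvec p))" by (simp add: fun_eq_iff mult.commute)
  ultimately show ?thesis by (simp add: has_field_derivative_def)
qed

lemma ray_holomorphic: "holomorphic2 E \<Longrightarrow> ray E y p holomorphic_on UNIV"
  by (metis kernel_derivative ray_has_derivative holomorphic_onI field_differentiable_def
      field_differentiable_at_within)

text \<open>For real \<open>z = t\<close> this is the eigenvalue equation in the direction \<open>\<xi> = t p\<close> at the point \<open>t p\<close>:
  the factor \<open>\<langle>\<alpha>, \<xi>\<rangle>\<close> then cancels the denominator \<open>\<langle>\<alpha>, t p\<rangle>\<close>. When \<open>t p\<close> lies on a reflecting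
  hyperplane both sides of this cancellation vanish. Complex \<open>z\<close> follow by analytic continuation.\<close>

lemma ray_equation:
  assumes "is_dunkl_kernel Rp k E"
  shows "z * deriv (ray E y p) z + (\<Sum>\<alpha>\<in>Rp. of_real (k \<alpha>) * (ray E y p z - ray E y (refl \<alpha> p) z))
    = z * of_real (p \<bullet> y) * ray E y p z"
proof (rule entire_eq_on_reals[where z = z])
  have hol: "holomorphic2 E" using assms by (simp add: is_dunkl_kernel_def)
  show "(\<lambda>z. z * deriv (ray E y p) z + (\<Sum>\<alpha>\<in>Rp. of_real (k \<alpha>) * (ray E y p z - ray E y (refl \<alpha> p) z))) holomorphic_on UNIV"
    by (intro holomorphic_intros ray_holomorphic hol open_UNIV)
  show "(\<lambda>z. z * of_real (p \<bullet> y) * ray E y p z) holomorphic_on UNIV"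
    by (intro holomorphic_intros ray_holomorphic hol)
  fix t :: real
  define f where "f = (\<lambda>x. E (cvec x) (cvec y))"
  have f_ray: "f (t *\<^sub>R q) = ray E y q (of_real t)" for q
    by (simp add: f_def ray_def cvec_scaleR)
  obtain D where D: "((\<lambda>u. E u (cvec y)) has_derivative D) (at (cvec (t *\<^sub>R p)))"
    "\<And>c v. D (c *s v) = c * D v"
    using kernel_derivative[OF hol] by blast
  have f_deriv: "(f has_derivative (\<lambda>\<xi>. D (cvec \<xi>))) (at (t *\<^sub>R p))"
    unfolding f_def
    by (rule has_derivative_compose[OF bounded_linear_imp_has_derivative[OF bounded_linear_cvec] D(1)])
  have ray_deriv: "(ray E y p has_field_derivative D (cvec p)) (at (of_real t))"
    using D by (intro ray_has_derivative) (simp_all add: cvec_scaleR)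
  have "frechet_derivative f (at (t *\<^sub>R p)) (t *\<^sub>R p) = of_real t * deriv (ray E y p) (of_real t)"
    by (simp add: frechet_derivative_at[OF f_deriv, symmetric] DERIV_imp_deriv[OF ray_deriv] D(2) cvec_scaleR)
  moreover have "of_real (\<alpha> \<bullet> (t *\<^sub>R p)) * dunkl_quotient \<alpha> f (t *\<^sub>R p)
      = ray E y p (of_real t) - ray E y (refl \<alpha> p) (of_real t)" for \<alpha>
  proof -
    have *: "refl \<alpha> (t *\<^sub>R p) = t *\<^sub>R refl \<alpha> p"
      by (rule linear_scale[OF linear_refl])
    show ?thesis
    proof (cases "\<alpha> \<bullet> (t *\<^sub>R p) = 0")
      case True
      then have "refl \<alpha> (t *\<^sub>R p) = t *\<^sub>R p" by (simp add: refl_def)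
      then have "ray E y (refl \<alpha> p) (of_real t) = ray E y p (of_real t)"
        by (metis * f_ray)
      then show ?thesis using True by simp
    next
      case False
      then show ?thesis by (simp add: dunkl_quotient_def * f_ray)
    qed
  qed
  moreover have "dunkl_operator Rp k (t *\<^sub>R p) f (t *\<^sub>R p)
      = cdot (cvec (t *\<^sub>R p)) (cvec y) * f (t *\<^sub>R p)"
    using assms unfolding is_dunkl_kernel_def dunkl_eigenfunction_def f_def by blast
  ultimately show "of_real t * deriv (ray E y p) (of_real t)
      + (\<Sum>\<alpha>\<in>Rp. of_real (k \<alpha>) * (ray E y p (of_real t) - ray E y (refl \<alpha> p) (of_real t)))
    = of_real t * of_real (p \<bullet> y) * ray E y p (of_real t)"
    by (simp add: dunkl_operator_def cdot_cvec f_ray mult.assoc)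
qed

lemma ray_zero: "is_dunkl_kernel Rp k E \<Longrightarrow> ray E y p 0 = 1"
  by (simp add: is_dunkl_kernel_def dunkl_eigenfunction_def ray_def cvec_def zero_vec_def vector_scalar_mult_def)

lemma ray_continuous:
  assumes "holomorphic2 E"
  shows "continuous_on UNIV (\<lambda>(p, s::real). ray E y p (of_real s * z))"
proof -
  have "continuous (at q) (\<lambda>(x, y). E x y)" for q
    using assms unfolding holomorphic2_def by (blast dest: has_derivative_continuous)
  then have E: "continuous_on UNIV (\<lambda>(x, y). E x y)"
    by (simp add: continuous_on_eq_continuous_within)
  have "continuous_on UNIV (\<lambda>(p::real^'n, s::real). ((of_real s * z) *s cvec p, cvec y))"
    unfolding vector_scalar_mult_def cvec_def case_prod_beta
    by (intro continuous_intros)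
  from continuous_on_compose[OF this continuous_on_subset[OF E subset_UNIV]]
  show ?thesis by (simp add: ray_def case_prod_beta o_def)
qed

lemma real_analytic_cnj:
  assumes "real_analytic f"
  shows "real_analytic (\<lambda>x. cnj (f x))"
  unfolding real_analytic_def
proof
  fix a
  have "\<exists>c. \<exists>r>0. \<forall>x. (\<forall>i. \<bar>x $ i - a $ i\<bar> < r) \<longrightarrow>
    ((\<lambda>m. c m * complex_of_real (\<Prod>i\<in>UNIV. (x $ i - a $ i) ^ m i)) has_sum f x) UNIV"
    using assms[unfolded real_analytic_def] by (rule spec)
  then obtain c r where r: "r > 0" and c: "\<forall>x. (\<forall>i. \<bar>x $ i - a $ i\<bar> < r) \<longrightarrow>
    ((\<lambda>m. c m * complex_of_real (\<Prod>i\<in>UNIV. (x $ i - a $ i) ^ m i)) has_sum f x) UNIV"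
    by (elim exE conjE) (rule that)
  show "\<exists>c. \<exists>r>0. \<forall>x. (\<forall>i. \<bar>x $ i - a $ i\<bar> < r) \<longrightarrow>
    ((\<lambda>m. c m * complex_of_real (\<Prod>i\<in>UNIV. (x $ i - a $ i) ^ m i)) has_sum cnj (f x)) UNIV"
  proof (intro exI conjI allI impI)
    fix x assume "\<forall>i. \<bar>x $ i - a $ i\<bar> < r"
    then have "((\<lambda>m. c m * complex_of_real (\<Prod>i\<in>UNIV. (x $ i - a $ i) ^ m i)) has_sum f x) UNIV"
      by (rule mp[OF spec[OF c]])
    then have "((\<lambda>m. cnj (c m * complex_of_real (\<Prod>i\<in>UNIV. (x $ i - a $ i) ^ m i))) has_sum cnj (f x)) UNIV"
      by (simp only: has_sum_cnj_iff)
    then show "((\<lambda>m. cnj (c m) * complex_of_real (\<Prod>i\<in>UNIV. (x $ i - a $ i) ^ m i)) has_sum cnj (f x)) UNIV"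
      by (simp only: complex_cnj_mult complex_cnj_complex_of_real)
  qed (rule r)
qed

text \<open>For real \<open>y\<close> the complex conjugate of \<open>E(\<cdot>, y)\<close> solves the same eigenvalue problem on the real space,
  so by uniqueness \<open>E(\<cdot>, y)\<close> is real there; the reflection principle extends this to complex \<open>z\<close>.\<close>

lemma ray_cnj:
  fixes y :: "real ^ 'n"
  assumes E: "is_dunkl_kernel Rp k E"
  shows "ray E y p (cnj z) = cnj (ray E y p z)"
proof -
  have hol: "holomorphic2 E" using E by (simp add: is_dunkl_kernel_def)
  define f where "f = (\<lambda>x. E (cvec x) (cvec y))"
  have eig: "dunkl_eigenfunction Rp k (cvec y) f"
    and uniq: "\<And>h. dunkl_eigenfunction Rp k (cvec y) h \<Longrightarrow> h = f"
    using E unfolding is_dunkl_kernel_def f_def by blast+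
  have diff: "(f has_derivative frechet_derivative f (at x)) (at x)" for x
  proof -
    obtain D where "((\<lambda>u. E u (cvec y)) has_derivative D) (at (cvec x))"
      using kernel_derivative[OF hol] by blast
    from has_derivative_compose[OF bounded_linear_imp_has_derivative[OF bounded_linear_cvec] this]
    show ?thesis unfolding f_def by (metis frechet_derivative_at)
  qed
  have frechet: "frechet_derivative (\<lambda>x. cnj (f x)) (at x) \<xi> = cnj (frechet_derivative f (at x) \<xi>)" for x \<xi>
    using frechet_derivative_at[OF bounded_linear.has_derivative[OF bounded_linear_cnj diff]] by metis
  have quotient: "dunkl_quotient \<alpha> (\<lambda>x. cnj (f x)) x = cnj (dunkl_quotient \<alpha> f x)" for \<alpha> x
    by (simp add: dunkl_quotient_def frechet)
  have "dunkl_eigenfunction Rp k (cvec y) (\<lambda>x. cnj (f x))"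
    unfolding dunkl_eigenfunction_def
  proof (intro conjI allI)
    show "real_analytic (\<lambda>x. cnj (f x))"
      using eig by (simp add: dunkl_eigenfunction_def real_analytic_cnj)
    show "cnj (f 0) = 1" using eig by (simp add: dunkl_eigenfunction_def)
    fix \<xi> x
    have "dunkl_operator Rp k \<xi> (\<lambda>x. cnj (f x)) x = cnj (dunkl_operator Rp k \<xi> f x)"
      by (simp add: dunkl_operator_def frechet quotient)
    also have "\<dots> = cdot (cvec \<xi>) (cvec y) * cnj (f x)"
      using eig by (simp add: dunkl_eigenfunction_def cdot_cvec)
    finally show "dunkl_operator Rp k \<xi> (\<lambda>x. cnj (f x)) x = cdot (cvec \<xi>) (cvec y) * cnj (f x)" .
  qed
  then have "(\<lambda>x. cnj (f x)) = f" by (rule uniq)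
  then have real: "cnj (f x) = f x" for x by (rule fun_cong)
  have "cnj (ray E y p (cnj (cnj z))) = ray E y p (cnj z)"
  proof (rule entire_eq_on_reals[where z = "cnj z"])
    show "(\<lambda>z. cnj (ray E y p (cnj z))) holomorphic_on UNIV"
      by (rule entire_cnj_cnj) (rule ray_holomorphic[OF hol])
    show "cnj (ray E y p (cnj (of_real t))) = ray E y p (of_real t)" for t
      using real[of "t *\<^sub>R p"] by (simp add: f_def ray_def cvec_scaleR)
  qed (rule ray_holomorphic[OF hol])
  then show ?thesis by simp
qed

section \<open>A maximum principle for the kernel on the orbit\<close>

text \<open>Let \<open>\<mu> > \<lambda> Re z\<close>, where \<open>\<lambda> = \<langle>x, y\<rangle>\<close>, and consider \<open>q(p, s) = |E(s z p, y)|\<^sup>2 exp(-2\<mu>s)\<close> for \<open>p\<close> in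
  the closed orbit and \<open>0 \<le> s \<le> 1\<close>. At a maximum with \<open>s > 0\<close> the differential equation would make
  \<open>q(p, \<cdot>)\<close> strictly decreasing: the reflection terms contribute with the right sign because no other
  orbit point has a larger value at the same \<open>s\<close>. So the maximum is at \<open>s = 0\<close>, where \<open>q = 1\<close>; then
  let \<open>\<mu>\<close> tend to \<open>\<lambda> Re z\<close>.\<close>

lemma (in positive_roots) ray_bound:
  assumes E: "is_dunkl_kernel Rp k E" and k: "\<And>\<alpha>. \<alpha> \<in> Rp \<Longrightarrow> 0 \<le> k \<alpha>"
    and x: "x \<in> chamber Rp" and y: "y \<in> chamber Rp" and z: "0 \<le> Re z"
  shows "norm (ray E y x z) \<le> exp (Re z * (x \<bullet> y))"
proof -
  have hol: "holomorphic2 E" using E by (simp add: is_dunkl_kernel_def)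
  obtain S where S: "compact S" "x \<in> S" "\<And>\<alpha> p. \<alpha> \<in> Rp \<Longrightarrow> p \<in> S \<Longrightarrow> refl \<alpha> p \<in> S"
    "\<And>p. p \<in> S \<Longrightarrow> p \<bullet> y \<le> x \<bullet> y"
    using compact_invariant_set[OF x y] by metis
  have strict: "(norm (ray E y x z))\<^sup>2 \<le> exp (2 * \<mu>)" if \<mu>: "Re z * (x \<bullet> y) < \<mu>" for \<mu>
  proof -
    define q where "q = (\<lambda>p s. (norm (ray E y p (of_real s * z)))\<^sup>2 * exp (- (2 * \<mu> * s)))"
    have "compact (S \<times> {0..1::real})" using S(1) by (intro compact_Times) auto
    moreover have "S \<times> {0..1::real} \<noteq> {}" using S(2) by auto
    moreover have "continuous_on (S \<times> {0..1}) (\<lambda>w. q (fst w) (snd w))"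
    proof -
      have "continuous_on UNIV (\<lambda>w. ray E y (fst w) (of_real (snd w) * z))"
        using ray_continuous[OF hol, of y z] by (simp add: case_prod_beta)
      then have "continuous_on (S \<times> {0..1}) (\<lambda>w. ray E y (fst w) (of_real (snd w) * z))"
        by (rule continuous_on_subset) simp
      then show ?thesis unfolding q_def by (intro continuous_intros)
    qed
    ultimately have "\<exists>w\<in>S \<times> {0..1}. \<forall>w'\<in>S \<times> {0..1}. q (fst w') (snd w') \<le> q (fst w) (snd w)"
      by (rule continuous_attains_sup)
    then obtain p s where p: "p \<in> S" and s: "0 \<le> s" "s \<le> 1"
      and max: "\<And>p' s'. p' \<in> S \<Longrightarrow> 0 \<le> s' \<Longrightarrow> s' \<le> 1 \<Longrightarrow> q p' s' \<le> q p s"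
      by fastforce
    have q0: "q p' 0 = 1" for p' by (simp add: q_def ray_zero[OF E])
    have "s = 0"
    proof (rule ccontr)
      assume "s \<noteq> 0"
      with s have s0: "0 < s" by simp
      define u where "u = ray E y p (of_real s * z)"
      define u' where "u' = deriv (ray E y p) (of_real s * z) * z"
      define v where "v = (\<lambda>\<alpha>. ray E y (refl \<alpha> p) (of_real s * z))"
      have "1 \<le> q p s" using max[OF S(2), of 0] q0 by simp
      then have u: "u \<noteq> 0" by (auto simp: q_def u_def)
      have v_le: "u \<bullet> v \<alpha> \<le> u \<bullet> u" if "\<alpha> \<in> Rp" for \<alpha>
      proof -
        have "q (refl \<alpha> p) s \<le> q p s" using max S(3)[OF that p] s by simp
        then have "norm (v \<alpha>) \<le> norm u"
          by (auto simp: q_def u_def v_def intro: power2_le_imp_le)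
        then have "norm u * norm (v \<alpha>) \<le> norm u * norm u" by (intro mult_left_mono) auto
        then show ?thesis
          using norm_cauchy_schwarz[of u "v \<alpha>"] by (simp add: dot_square_norm power2_eq_square)
      qed
      have "of_real s * u' + (\<Sum>\<alpha>\<in>Rp. of_real (k \<alpha>) * (u - v \<alpha>)) = of_real (s * (p \<bullet> y)) * (z * u)"
        using ray_equation[OF E, of "of_real s * z" y p]
        by (simp add: u_def u'_def v_def mult_ac)
      then have eq: "s *\<^sub>R u' = (s * (p \<bullet> y)) *\<^sub>R (z * u) - (\<Sum>\<alpha>\<in>Rp. k \<alpha> *\<^sub>R (u - v \<alpha>))"
        unfolding scaleR_conv_of_real by (simp add: algebra_simps)
      \<comment> \<open>In the real inner product of complex numbers, \<open>u \<bullet> u'\<close> is half the derivative of the squared modulus.\<close>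
      have "s * (u \<bullet> u') = u \<bullet> (s *\<^sub>R u')" by simp
      also have "\<dots> = s * (p \<bullet> y) * (u \<bullet> (z * u)) - (\<Sum>\<alpha>\<in>Rp. k \<alpha> * (u \<bullet> u - u \<bullet> v \<alpha>))"
        unfolding eq by (simp add: inner_diff_right inner_sum_right)
      also have "u \<bullet> (z * u) = Re z * (u \<bullet> u)" by (simp add: inner_complex_def algebra_simps)
      also have "s * (p \<bullet> y) * (Re z * (u \<bullet> u)) - (\<Sum>\<alpha>\<in>Rp. k \<alpha> * (u \<bullet> u - u \<bullet> v \<alpha>))
          \<le> s * (p \<bullet> y) * (Re z * (u \<bullet> u))"
        using k v_le by (simp add: sum_nonneg)
      also have "\<dots> = s * (u \<bullet> u) * (Re z * (p \<bullet> y))" by simp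
      also have "\<dots> \<le> s * (u \<bullet> u) * (Re z * (x \<bullet> y))"
        using S(4)[OF p] z s0 by (intro mult_left_mono) auto
      also have "\<dots> < s * (u \<bullet> u) * \<mu>" using \<mu> s0 u by (intro mult_strict_left_mono) auto
      finally have neg: "u \<bullet> u' < \<mu> * (u \<bullet> u)" using s0 by (simp add: mult_ac)
      have "((\<lambda>w. ray E y p (w * z)) has_field_derivative u') (at (of_real s))"
        unfolding u'_def
      proof (rule DERIV_chain2[where f = "ray E y p" and g = "\<lambda>w. w * z"])
        show "(ray E y p has_field_derivative deriv (ray E y p) (of_real s * z)) (at (of_real s * z))"
          using ray_holomorphic[OF hol] by (rule holomorphic_derivI) auto
        show "((\<lambda>w. w * z) has_field_derivative z) (at (of_real s))"
          by (auto intro!: derivative_eq_intros)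
      qed
      then have "((\<lambda>s. ray E y p (of_real s * z)) has_vector_derivative u') (at s)"
        by (rule has_vector_derivative_real_field)
      then have der: "((\<lambda>s. ray E y p (of_real s * z)) has_derivative (\<lambda>h. h *\<^sub>R u')) (at s)"
        by (simp add: has_vector_derivative_def)
      have "((\<lambda>s. ray E y p (of_real s * z) \<bullet> ray E y p (of_real s * z)) has_derivative
          (\<lambda>h. u \<bullet> (h *\<^sub>R u') + (h *\<^sub>R u') \<bullet> u)) (at s)"
        unfolding u_def by (rule has_derivative_inner[OF der der])
      then have "((\<lambda>s. (norm (ray E y p (of_real s * z)))\<^sup>2) has_field_derivative 2 * (u \<bullet> u')) (at s)"
        unfolding has_field_derivative_def power2_norm_eq_inner
        by (rule has_derivative_eq_rhs) (simp add: fun_eq_iff inner_commute)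
      moreover have "((\<lambda>s. exp (- (2 * \<mu> * s))) has_field_derivative
          exp (- (2 * \<mu> * s)) * - (2 * \<mu>)) (at s)"
        by (auto intro!: derivative_eq_intros)
      ultimately have "(q p has_field_derivative
          2 * (u \<bullet> u') * exp (- (2 * \<mu> * s)) + exp (- (2 * \<mu> * s)) * - (2 * \<mu>) * (norm u)\<^sup>2) (at s)"
        unfolding q_def u_def by (rule DERIV_mult)
      moreover have "2 * (u \<bullet> u') * exp (- (2 * \<mu> * s)) + exp (- (2 * \<mu> * s)) * - (2 * \<mu>) * (norm u)\<^sup>2
          = exp (- (2 * \<mu> * s)) * (2 * (u \<bullet> u' - \<mu> * (u \<bullet> u)))"
        by (simp add: power2_norm_eq_inner algebra_simps)
      moreover have "\<dots> < 0" using neg by (simp add: mult_pos_neg)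
      ultimately obtain d where d: "0 < d" "\<And>h. 0 < h \<Longrightarrow> h < d \<Longrightarrow> q p s < q p (s - h)"
        using DERIV_neg_dec_left by metis
      \<comment> \<open>The step to the left must stay inside the unit interval.\<close>
      define h where "h = min (d / 2) s"
      have "0 < h" "h < d" "h \<le> s" using d(1) s0 by (auto simp: h_def)
      then have "q p s < q p (s - h)" "q p (s - h) \<le> q p s"
        using d(2) max[OF p, of "s - h"] s by auto
      then show False by simp
    qed
    then have "q x 1 \<le> 1" using max[OF S(2), of 1] q0 by simp
    then show ?thesis by (simp add: q_def exp_minus field_simps)
  qed
  have "norm (ray E y x z) \<le> exp (Re z * (x \<bullet> y) + e)" if "0 < e" for e
  proof -
    have "(norm (ray E y x z))\<^sup>2 \<le> (exp (Re z * (x \<bullet> y) + e))\<^sup>2"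
      by (rule strict[of "Re z * (x \<bullet> y) + e", unfolded exp_double]) (use that in simp)
    then show ?thesis by (rule power2_le_imp_le) simp
  qed
  then have "\<forall>\<^sub>F e in at_right 0. norm (ray E y x z) \<le> exp (Re z * (x \<bullet> y) + e)"
    using eventually_at_right_less by (rule eventually_mono[rotated])
  moreover have "((\<lambda>e. exp (Re z * (x \<bullet> y) + e)) \<longlongrightarrow> exp (Re z * (x \<bullet> y) + 0)) (at_right 0)"
    by (intro tendsto_intros)
  ultimately show ?thesis by (intro tendsto_lowerbound[where F = "at_right 0"]) auto
qed

section \<open>Phragmen-Lindelof principles in the right half plane\<close>

text \<open>Dividing by \<open>(1 + e z)\<^sup>n\<close> with \<open>n > m\<close> makes \<open>f\<close> decay at infinity without enlarging it on the
  imaginary axis, since \<open>|1 + e z| \<ge> 1\<close> in the half plane. The maximum modulus principle on large half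
  discs bounds the quotient, and \<open>e\<close> tends to \<open>0\<close>.\<close>

lemma Phragmen_Lindelof_half_plane:
  assumes cont: "continuous_on {z. 0 \<le> Re z} f" and hol: "f holomorphic_on {z. 0 < Re z}"
    and growth: "\<And>z. 0 \<le> Re z \<Longrightarrow> norm (f z) \<le> C * (1 + norm z) ^ m"
    and axis: "\<And>z. Re z = 0 \<Longrightarrow> norm (f z) \<le> B"
    and w: "0 \<le> Re w"
  shows "norm (f w) \<le> B"
proof -
  have B: "0 \<le> B" using axis[of 0] norm_ge_zero[of "f 0"] by (simp del: norm_ge_zero)
  have C: "0 \<le> C" using growth[of 0] norm_ge_zero[of "f 0"] by (simp del: norm_ge_zero)
  have damped: "norm (f w) \<le> B * norm (1 + of_real e * w) ^ Suc m" if e: "0 < e" for e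
  proof -
    define D where "D = (\<lambda>z::complex. 1 + of_real e * z)"
    have D_ge: "1 \<le> norm (D z)" "e * norm z \<le> norm (D z)" if "0 \<le> Re z" for z
    proof -
      have "1 \<le> Re (D z)" using that e by (simp add: D_def)
      then show "1 \<le> norm (D z)" using complex_Re_le_cmod order_trans by blast
      have "(norm (D z))\<^sup>2 = 1 + 2 * (e * Re z) + (e * norm z)\<^sup>2"
        unfolding power_mult_distrib cmod_power2
        by (simp add: D_def power2_eq_square algebra_simps)
      then have "(e * norm z)\<^sup>2 \<le> (norm (D z))\<^sup>2" using that e by simp
      then show "e * norm z \<le> norm (D z)" by (rule power2_le_imp_le) simp
    qed
    have D_nz: "D z \<noteq> 0" if "0 \<le> Re z" for z using D_ge(1)[OF that] by auto
    define q where "q = (\<lambda>z. f z / D z ^ Suc m)"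
    have lim: "((\<lambda>\<rho>::real. C * (1 + \<rho>) ^ m / (e * \<rho>) ^ Suc m) \<longlongrightarrow> 0) at_top"
      using e C by real_asymp
    have "norm (q w) \<le> B + \<eta>" if \<eta>: "0 < \<eta>" for \<eta>
    proof -
      have "\<forall>\<^sub>F \<rho> in at_top. C * (1 + \<rho>) ^ m / (e * \<rho>) ^ Suc m < \<eta> \<and> norm w < \<rho>"
        using order_tendstoD(2)[OF lim \<eta>] eventually_gt_at_top by (rule eventually_conj)
      then obtain \<rho> where \<rho>: "C * (1 + \<rho>) ^ m / (e * \<rho>) ^ Suc m < \<eta>" "norm w < \<rho>"
        using eventually_happens'[OF trivial_limit_at_top_linorder] by blast
      have \<rho>0: "0 < \<rho>" using \<rho>(2) norm_ge_zero[of w] by linarith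
      define S where "S = cball 0 \<rho> \<inter> {z. 0 \<le> Re z}"
      have closed: "closed S" unfolding S_def by (intro closed_Int closed_cball closed_halfspace_Re_ge)
      have int: "interior S = ball 0 \<rho> \<inter> {z. 0 < Re z}"
          using \<rho>0 interior_halfspace_ge[of "1::complex" 0] by (simp add: S_def inner_complex_def)
      show ?thesis
      proof (rule maximum_modulus_frontier[of q S])
        show "q holomorphic_on interior S"
          unfolding q_def int D_def
          by (intro holomorphic_intros holomorphic_on_subset[OF hol]) (use D_nz D_def in auto)
        show "continuous_on (closure S) q"
          unfolding q_def closure_closed[OF closed] D_def
          by (intro continuous_intros continuous_on_subset[OF cont]) (use D_nz D_def S_def in auto)
        show "bounded S" by (simp add: S_def bounded_Int)
        show "w \<in> S" using w \<rho> by (simp add: S_def)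
        fix z assume "z \<in> frontier S"
        then have z: "norm z \<le> \<rho>" "0 \<le> Re z" "norm z = \<rho> \<or> Re z = 0"
          unfolding frontier_def closure_closed[OF closed] int by (auto simp: S_def)
        have norm_q: "norm (q z) = norm (f z) / norm (D z) ^ Suc m"
          by (simp add: q_def norm_divide norm_power norm_mult)
        show "norm (q z) \<le> B + \<eta>"
        proof (cases "Re z = 0")
          case True
          have "norm (q z) \<le> norm (f z)"
            unfolding norm_q using one_le_power[OF D_ge(1)[OF z(2)], of "Suc m"]
              mult_left_mono[of 1 "norm (D z) ^ Suc m" "norm (f z)"]
            by (simp add: divide_le_eq del: power_Suc)
          then show ?thesis using axis[OF True] \<eta> by linarith
        next
          case False
          then have nz: "norm z = \<rho>" using z by simp
          have "norm (q z) \<le> C * (1 + \<rho>) ^ m / (e * \<rho>) ^ Suc m"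
            unfolding norm_q
          proof (rule frac_le)
            show "0 \<le> C * (1 + \<rho>) ^ m" using C \<rho>0 by simp
            show "norm (f z) \<le> C * (1 + \<rho>) ^ m" using growth[OF z(2)] nz by simp
            show "0 < (e * \<rho>) ^ Suc m" using e \<rho>0 by (intro zero_less_power) simp
            show "(e * \<rho>) ^ Suc m \<le> norm (D z) ^ Suc m"
              using D_ge(2)[OF z(2)] nz e \<rho>0 by (intro power_mono) auto
          qed
          then show ?thesis using \<rho>(1) B by linarith
        qed
      qed
    qed
    then have "norm (q w) \<le> B" by (rule field_le_epsilon)
    then show ?thesis
      using D_nz[OF w] by (simp add: q_def norm_divide norm_power norm_mult divide_le_eq D_def del: power_Suc)
  qed
  have "((\<lambda>e. B * norm (1 + of_real e * w) ^ Suc m) \<longlongrightarrow> B * norm (1 + of_real 0 * w) ^ Suc m) (at_right 0)"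
    by (intro tendsto_intros)
  then have "((\<lambda>e. B * norm (1 + of_real e * w) ^ Suc m) \<longlongrightarrow> B) (at_right 0)" by simp
  then show ?thesis
  proof (rule tendsto_lowerbound)
    show "\<forall>\<^sub>F e in at_right 0. norm (f w) \<le> B * norm (1 + of_real e * w) ^ Suc m"
      using damped eventually_at_right_less by (rule eventually_mono[rotated]) 
  qed simp
qed

text \<open>Multiplication by \<open>z / (z + K)\<close> with large \<open>K\<close> suppresses \<open>f\<close> on the bounded part of the imaginary
  axis where it is not yet small, and costs at most a factor \<open>2\<close> once \<open>|z| \<ge> K\<close>. The preceding
  principle then spreads smallness from the axis to the half plane.\<close>

lemma half_plane_tendsto_zero:
  assumes cont: "continuous_on {z. 0 \<le> Re z} f" and hol: "f holomorphic_on {z. 0 < Re z}"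
    and bdd: "\<And>z. 0 \<le> Re z \<Longrightarrow> norm (f z) \<le> M"
    and up: "((\<lambda>t::real. f (\<i> * of_real t)) \<longlongrightarrow> 0) at_top"
    and down: "((\<lambda>t::real. f (- (\<i> * of_real t))) \<longlongrightarrow> 0) at_top"
  shows "(f \<longlongrightarrow> 0) (inf at_infinity (principal {z. 0 \<le> Re z}))"
proof (rule tendstoI)
  fix \<epsilon> :: real assume "0 < \<epsilon>"
  define \<eta> where "\<eta> = \<epsilon> / 4"
  have \<eta>: "0 < \<eta>" using \<open>0 < \<epsilon>\<close> by (simp add: \<eta>_def)
  have M: "0 \<le> M" using bdd[of 0] norm_ge_zero[of "f 0"] by (simp del: norm_ge_zero)
  have "\<forall>\<^sub>F t in at_top. norm (f (\<i> * of_real t)) < \<eta> \<and> norm (f (- (\<i> * of_real t))) < \<eta>"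
    using tendstoD[OF up \<eta>] tendstoD[OF down \<eta>] by (auto intro: eventually_conj)
  then obtain Y0 where Y0: "\<And>t. Y0 \<le> t \<Longrightarrow> norm (f (\<i> * of_real t)) < \<eta> \<and> norm (f (- (\<i> * of_real t))) < \<eta>"
    unfolding eventually_at_top_linorder by blast
  define Y where "Y = max Y0 1"
  \<comment> \<open>On the axis \<open>|z / (z + K)| \<le> Y / K\<close> for \<open>|z| \<le> Y\<close>, which outweighs the bound \<open>M\<close> on \<open>f\<close>.\<close>
  define K where "K = (M + 1) * Y / \<eta>"
  have Y: "1 \<le> Y" and K: "0 < K" using M \<eta> by (auto simp: Y_def K_def)
  define g where "g = (\<lambda>z. f z * (z / (z + of_real K)))"
  have nz: "z + of_real K \<noteq> 0" if "0 \<le> Re z" for z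
  proof
    assume "z + of_real K = 0"
    then have "Re z + K = 0" by (simp add: complex_eq_iff)
    then show False using that K by simp
  qed
  have norm_g: "norm (g z) = norm (f z) * (norm z / norm (z + of_real K))" for z
    by (simp add: g_def norm_mult norm_divide)
  have ratio_le: "norm z / norm (z + of_real K) \<le> 1" if "0 \<le> Re z" for z
  proof -
    have "(norm z)\<^sup>2 \<le> (norm (z + of_real K))\<^sup>2"
      using that K by (simp add: cmod_power2 power2_sum)
    then have "norm z \<le> norm (z + of_real K)" by (rule power2_le_imp_le) simp
    then show ?thesis using nz[OF that] by simp
  qed
  have g_bound: "norm (g z) \<le> \<eta>" if "0 \<le> Re z" for z
  proof (rule Phragmen_Lindelof_half_plane[where f = g and w = z and C = M and m = 0])
    show "continuous_on {z. 0 \<le> Re z} g"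
      unfolding g_def by (intro continuous_intros cont) (use nz in auto)
    show "g holomorphic_on {z. 0 < Re z}"
      unfolding g_def by (intro holomorphic_intros hol) (use nz in auto)
    show "norm (g z) \<le> M * (1 + norm z) ^ 0" if "0 \<le> Re z" for z
      unfolding norm_g using mult_mono[OF bdd[OF that] ratio_le[OF that]] M by simp
  next
    fix z :: complex assume z: "Re z = 0"
    then have z_eq: "z = \<i> * of_real (Im z)" by (simp add: complex_eq_iff)
    show "norm (g z) \<le> \<eta>"
    proof (cases "Y \<le> \<bar>Im z\<bar>")
      case True
      then have "norm (f z) \<le> \<eta>"
        using Y0[of "\<bar>Im z\<bar>"] z_eq by (cases "0 \<le> Im z") (auto simp: Y_def)
      then have "norm (g z) \<le> \<eta> * 1"
        unfolding norm_g using ratio_le[of z] z \<eta> by (intro mult_mono) auto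
      then show ?thesis by simp
    next
      case False
      have n: "norm z = \<bar>Im z\<bar>" by (subst z_eq) (simp add: norm_mult)
      have "K \<le> norm (z + of_real K)" using complex_Re_le_cmod[of "z + of_real K"] z by simp
      then have "norm z / norm (z + of_real K) \<le> Y / K"
        using False n K Y by (intro frac_le) auto
      then have "norm (g z) \<le> M * (Y / K)"
        unfolding norm_g using bdd[of z] z M by (intro mult_mono) auto
      also have "Y / K = \<eta> / (M + 1)" using Y by (simp add: K_def)
      also have "M * (\<eta> / (M + 1)) = \<eta> * (M / (M + 1))" by simp
      also have "\<dots> \<le> \<eta> * 1" using M \<eta> by (intro mult_left_mono) auto
      finally show ?thesis by simp
    qed
  qed (use that in auto)
  have far: "norm (f z) < \<epsilon>" if "0 \<le> Re z" "K \<le> norm z" for z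
  proof -
    have "norm (z + of_real K) \<le> 2 * norm z"
      using norm_triangle_ineq[of z "of_real K"] K that by simp
    then have "1 / 2 \<le> norm z / norm (z + of_real K)"
      using nz[OF that(1)] by (simp add: field_simps)
    then have "norm (f z) * (1 / 2) \<le> norm (g z)"
      unfolding norm_g by (intro mult_left_mono) auto
    then show ?thesis using g_bound[OF that(1)] \<eta> by (simp add: \<eta>_def)
  qed
  show "\<forall>\<^sub>F z in inf at_infinity (principal {z. 0 \<le> Re z}). dist (f z) 0 < \<epsilon>"
    unfolding eventually_inf_principal eventually_at_infinity
    using far by auto
qed

text \<open>A limit at one end of the imaginary axis suffices because conjugation provides the one at the other
  end. That the two limits agree is part of the argument and not an assumption: \<open>(f - a) (f - cnj a)\<close>
  tends to \<open>0\<close> in the half plane, and on the positive reals each of its factors has modulus at least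
  \<open>|Im a|\<close>.\<close>

lemma symmetric_half_plane_tendsto:
  assumes cont: "continuous_on {z. 0 \<le> Re z} f" and hol: "f holomorphic_on {z. 0 < Re z}"
    and growth: "\<And>z. 0 \<le> Re z \<Longrightarrow> norm (f z) \<le> (1 + norm z) ^ m"
    and sym: "\<And>z. 0 \<le> Re z \<Longrightarrow> f (cnj z) = cnj (f z)"
    and lim: "((\<lambda>t::real. f (\<i> * of_real t)) \<longlongrightarrow> a) at_top"
  shows "(f \<longlongrightarrow> a) (inf at_infinity (principal {z. 0 \<le> Re z}))"
proof -
  have lim': "((\<lambda>t::real. f (- (\<i> * of_real t))) \<longlongrightarrow> cnj a) at_top"
    using tendsto_cnj[OF lim] sym[of "\<i> * of_real _"] by simp
  have "\<exists>M. \<forall>z. Re z = 0 \<longrightarrow> norm (f z) \<le> M"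
  proof -
    have "\<forall>\<^sub>F t in at_top. norm (f (\<i> * of_real t)) < norm a + 1"
      using tendsto_norm[OF lim] by (rule order_tendstoD) simp
    then obtain Y where Y: "\<And>t. Y \<le> t \<Longrightarrow> norm (f (\<i> * of_real t)) < norm a + 1"
      unfolding eventually_at_top_linorder by blast
    have "norm (f z) \<le> max (norm a + 1) ((1 + \<bar>Y\<bar>) ^ m)" if z: "Re z = 0" for z
    proof (cases "Y \<le> \<bar>Im z\<bar>")
      case True
      have "z = \<i> * of_real \<bar>Im z\<bar> \<or> z = cnj (\<i> * of_real \<bar>Im z\<bar>)"
        using z by (auto simp: complex_eq_iff abs_if)
      then have "norm (f z) = norm (f (\<i> * of_real \<bar>Im z\<bar>))"
        using sym[of "\<i> * of_real \<bar>Im z\<bar>"] by auto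
      then show ?thesis using Y[OF True] by simp
    next
      case False
      have "norm z = \<bar>Im z\<bar>" using z by (simp add: cmod_eq_Im)
      then have "(1 + norm z) ^ m \<le> (1 + \<bar>Y\<bar>) ^ m" using False by (intro power_mono) auto
      then show ?thesis using growth[of z] z by simp
    qed
    then show ?thesis by blast
  qed
  then obtain M where M: "\<And>z. Re z = 0 \<Longrightarrow> norm (f z) \<le> M" by blast
  have bdd: "norm (f z) \<le> M" if "0 \<le> Re z" for z
    using Phragmen_Lindelof_half_plane[OF cont hol, of 1 m M z] growth M that by simp
  define h where "h = (\<lambda>z. (f z - a) * (f z - cnj a))"
  have h: "(h \<longlongrightarrow> 0) (inf at_infinity (principal {z. 0 \<le> Re z}))"
  proof (rule half_plane_tendsto_zero)
    show "continuous_on {z. 0 \<le> Re z} h" unfolding h_def by (intro continuous_intros cont)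
    show "h holomorphic_on {z. 0 < Re z}" unfolding h_def by (intro holomorphic_intros hol)
    show "norm (h z) \<le> (M + norm a) * (M + norm a)" if "0 \<le> Re z" for z
    proof -
      have "norm (f z - a) \<le> M + norm a" "norm (f z - cnj a) \<le> M + norm a"
        using norm_triangle_ineq4[of "f z" a] norm_triangle_ineq4[of "f z" "cnj a"] bdd[OF that] by auto
      then show ?thesis
        unfolding h_def norm_mult by (intro mult_mono) (auto intro: order_trans[OF norm_ge_zero])
    qed
    have "((\<lambda>t::real. h (\<i> * of_real t)) \<longlongrightarrow> (a - a) * (a - cnj a)) at_top"
      unfolding h_def by (intro tendsto_intros lim)
    then show "((\<lambda>t::real. h (\<i> * of_real t)) \<longlongrightarrow> 0) at_top" by simp
    have "((\<lambda>t::real. h (- (\<i> * of_real t))) \<longlongrightarrow> (cnj a - a) * (cnj a - cnj a)) at_top"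
      unfolding h_def by (intro tendsto_intros lim')
    then show "((\<lambda>t::real. h (- (\<i> * of_real t))) \<longlongrightarrow> 0) at_top" by simp
  qed
  have ray: "filterlim (\<lambda>t. complex_of_real t) (inf at_infinity (principal {z. 0 \<le> Re z})) at_top"
    unfolding filterlim_inf filterlim_principal
    by (auto intro: filterlim_of_real_at_infinity eventually_mono[OF eventually_ge_at_top[of 0]])
  have "a \<in> \<real>"
  proof -
    have "((\<lambda>t. norm (h (of_real t))) \<longlongrightarrow> 0) at_top"
      using tendsto_norm[OF filterlim_compose[OF h ray]] by simp
    moreover have "\<forall>\<^sub>F t in at_top. (Im a)\<^sup>2 \<le> norm (h (of_real t))"
      using eventually_ge_at_top[of 0]
    proof eventually_elim
      case (elim t)
      have "Im (f (of_real t)) = 0" using sym[of "of_real t"] elim by (simp add: complex_eq_iff)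
      then have "\<bar>Im a\<bar> \<le> norm (f (of_real t) - a)" "\<bar>Im a\<bar> \<le> norm (f (of_real t) - cnj a)"
        using abs_Im_le_cmod[of "f (of_real t) - a"] abs_Im_le_cmod[of "f (of_real t) - cnj a"] by auto
      then have "\<bar>Im a\<bar> * \<bar>Im a\<bar> \<le> norm (h (of_real t))"
        unfolding h_def norm_mult by (intro mult_mono) auto
      then show ?case by (simp add: power2_eq_square)
    qed
    ultimately have "(Im a)\<^sup>2 \<le> 0" by (intro tendsto_lowerbound) auto
    then show ?thesis by (simp add: complex_is_Real_iff)
  qed
  then have "h z = (f z - a)\<^sup>2" for z by (simp add: h_def Reals_cnj_iff power2_eq_square)
  then have "((\<lambda>z. (norm (f z - a))\<^sup>2) \<longlongrightarrow> 0) (inf at_infinity (principal {z. 0 \<le> Re z}))"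
    using tendsto_norm[OF h] by (simp add: norm_power)
  from tendsto_real_sqrt[OF this] have "((\<lambda>z. norm (f z - a)) \<longlongrightarrow> 0) (inf at_infinity (principal {z. 0 \<le> Re z}))"
    by simp
  then show ?thesis using Lim_null tendsto_norm_zero_iff by blast
qed

section \<open>The limit along the imaginary axis\<close>

lemma positive_roots_of_subsystem:
  assumes R: "normalized_root_system R" and Rp: "positive_subsystem R Rp"
  shows "positive_roots Rp"
proof
  have sub: "Rp \<subseteq> R" using Rp by (auto simp: positive_subsystem_def)
  show "finite Rp" using R sub by (auto simp: normalized_root_system_def intro: finite_subset)
  show "\<alpha> \<bullet> \<alpha> = 2" if "\<alpha> \<in> Rp" for \<alpha>
    using R sub that by (auto simp: normalized_root_system_def)
  show "refl \<alpha> \<beta> \<in> Rp \<or> - refl \<alpha> \<beta> \<in> Rp" if "\<alpha> \<in> Rp" "\<beta> \<in> Rp" for \<alpha> \<beta>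
  proof -
    have "refl \<alpha> \<beta> \<in> R" using R sub that unfolding normalized_root_system_def by blast
    then show ?thesis using Rp by (auto simp: positive_subsystem_def)
  qed
qed

lemma weight_pos: "finite Rp \<Longrightarrow> x \<in> chamber Rp \<Longrightarrow> 0 < weight Rp k x"
  unfolding weight_def chamber_def by (intro prod_pos) force

lemma weight_scaleR:
  assumes "finite Rp" "0 < t"
  shows "weight Rp k (t *\<^sub>R x) = (t powr gamma_index Rp k)\<^sup>2 * weight Rp k x"
proof -
  have "(t powr gamma_index Rp k)\<^sup>2 = t powr (\<Sum>\<alpha>\<in>Rp. 2 * k \<alpha>)"
    by (simp add: power2_eq_square powr_add[symmetric] gamma_index_def sum_distrib_left[symmetric])
  also have "\<dots> = (\<Prod>\<alpha>\<in>Rp. t powr (2 * k \<alpha>))" using assms by (intro powr_sum) auto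
  finally show ?thesis
    using assms by (simp add: weight_def abs_mult powr_mult prod.distrib)
qed

lemma chamber_cone_ray:
  assumes "finite Rp" "x \<in> chamber Rp"
  obtains \<delta> where "0 < \<delta>" "\<And>t. 0 < t \<Longrightarrow> t *\<^sub>R x \<in> chamber_cone Rp \<delta>"
proof -
  define m where "m = Min (insert 1 ((\<lambda>\<alpha>. \<alpha> \<bullet> x) ` Rp))"
  have m: "0 < m" using assms by (auto simp: m_def chamber_def)
  have m_le: "m \<le> \<alpha> \<bullet> x" if "\<alpha> \<in> Rp" for \<alpha>
    unfolding m_def using assms(1) that by (intro Min_le) auto
  define \<delta> where "\<delta> = m / (norm x + 1)"
  have \<delta>: "0 < \<delta>" using m by (simp add: \<delta>_def add_nonneg_pos)
  have "\<delta> * norm x < m"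
  proof -
    have "\<delta> * norm x < \<delta> * (norm x + 1)" using \<delta> by simp
    also have "\<dots> = m" using norm_ge_zero[of x] by (simp add: \<delta>_def add_nonneg_eq_0_iff)
    finally show ?thesis .
  qed
  then have less: "\<delta> * norm x < \<alpha> \<bullet> x" if "\<alpha> \<in> Rp" for \<alpha> using m_le[OF that] by linarith
  have "t *\<^sub>R x \<in> chamber_cone Rp \<delta>" if "0 < t" for t
    using assms(2) less that by (auto simp: chamber_cone_def chamber_def mult.left_commute[of \<delta> t])
  then show thesis using that \<delta> by blast
qed

text \<open>The points \<open>t x\<close> stay in one cone \<open>C\<^sub>\<delta>\<close>, and the homogeneity of the weight turns its square root into
  the factor \<open>t\<^sup>\<gamma>\<close>. The point \<open>x = 0\<close>, which belongs to the chamber when there are no roots, has to be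
  excluded as its ray does not tend to infinity.\<close>

lemma asymptotic_imaginary_axis:
  assumes Rp: "finite Rp" and E: "is_asymptotic_constant Rp k E v"
    and x: "x \<in> chamber Rp" "x \<noteq> 0" and y: "y \<in> chamber Rp"
  shows "((\<lambda>t. (\<i> * of_real t) powr of_real (gamma_index Rp k) * exp (- (\<i> * of_real t) * of_real (x \<bullet> y))
      * ray E y x (\<i> * of_real t)) \<longlongrightarrow> \<i> powr of_real (gamma_index Rp k) * v /
         of_real (sqrt (weight Rp k x * weight Rp k y))) at_top"
proof -
  define \<gamma> where "\<gamma> = gamma_index Rp k"
  define W where "W = sqrt (weight Rp k x * weight Rp k y)"
  have W: "0 < W" using weight_pos[OF Rp] x y by (simp add: W_def)
  obtain \<delta> where \<delta>: "0 < \<delta>" "\<And>t. 0 < t \<Longrightarrow> t *\<^sub>R x \<in> chamber_cone Rp \<delta>"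
    using chamber_cone_ray[OF Rp x(1)] by metis
  have "filterlim (\<lambda>t. t *\<^sub>R x) at_infinity at_top"
  proof (rule filterlim_norm_at_top_imp_at_infinity)
    have "filterlim (\<lambda>t. norm x * \<bar>t\<bar>) at_top at_top"
      using x(2) by (intro filterlim_tendsto_pos_mult_at_top[OF tendsto_const] filterlim_abs_real filterlim_ident) auto
    then show "filterlim (\<lambda>t. norm (t *\<^sub>R x)) at_top at_top" by (simp add: mult.commute)
  qed
  moreover have "\<forall>\<^sub>F t in at_top. t *\<^sub>R x \<in> chamber_cone Rp \<delta>"
    using eventually_gt_at_top[of 0] by eventually_elim (rule \<delta>(2))
  ultimately have ray: "filterlim (\<lambda>t. t *\<^sub>R x) (inf at_infinity (principal (chamber_cone Rp \<delta>))) at_top"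
    by (simp add: filterlim_inf filterlim_principal)
  have "((\<lambda>p. complex_of_real (sqrt (weight Rp k p * weight Rp k y)) *
      exp (- \<i> * complex_of_real (p \<bullet> y)) * E (\<i> *s cvec p) (cvec y)) \<longlongrightarrow> v)
      (inf at_infinity (principal (chamber_cone Rp \<delta>)))"
    using E y \<delta>(1) unfolding is_asymptotic_constant_def by blast
  from filterlim_compose[OF this ray] have "((\<lambda>t. \<i> powr of_real \<gamma> / of_real W * (complex_of_real (sqrt (weight Rp k (t *\<^sub>R x) * weight Rp k y)) *
      exp (- \<i> * complex_of_real ((t *\<^sub>R x) \<bullet> y)) * E (\<i> *s cvec (t *\<^sub>R x)) (cvec y)))
      \<longlongrightarrow> \<i> powr of_real \<gamma> / of_real W * v) at_top"
    by (intro tendsto_intros)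
  moreover have "\<forall>\<^sub>F t in at_top. \<i> powr of_real \<gamma> / of_real W * (complex_of_real (sqrt (weight Rp k (t *\<^sub>R x) * weight Rp k y)) *
      exp (- \<i> * complex_of_real ((t *\<^sub>R x) \<bullet> y)) * E (\<i> *s cvec (t *\<^sub>R x)) (cvec y))
    = (\<i> * of_real t) powr of_real \<gamma> * exp (- (\<i> * of_real t) * of_real (x \<bullet> y)) * ray E y x (\<i> * of_real t)"
    using eventually_gt_at_top[of 0]
  proof eventually_elim
    case (elim t)
    have "sqrt (weight Rp k (t *\<^sub>R x) * weight Rp k y) = t powr \<gamma> * W"
      by (simp add: weight_scaleR[OF Rp elim] W_def \<gamma>_def real_sqrt_mult)
    moreover have "(\<i> * of_real t) powr of_real \<gamma> = \<i> powr of_real \<gamma> * of_real (t powr \<gamma>)"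
      using powr_times_real_left[of "of_real t" \<i> "of_real \<gamma>"] powr_of_real[of t \<gamma>] elim
      by (simp add: mult.commute)
    moreover have "E (\<i> *s cvec (t *\<^sub>R x)) (cvec y) = ray E y x (\<i> * of_real t)"
      by (simp add: ray_def cvec_scaleR vector_smult_assoc)
    ultimately show ?case using W by (simp add: mult_ac)
  qed
  ultimately show ?thesis
    unfolding \<gamma>_def[symmetric] W_def[symmetric] times_divide_eq_left
    by (rule Lim_transform_eventually)
qed

text \<open>This allows the use of \<open>(z + 1)\<^sup>\<gamma>\<close> in place of \<open>z\<^sup>\<gamma>\<close>, which fails to be holomorphic at the boundary
  point \<open>0\<close> of the half plane.\<close>

lemma powr_shift_tendsto:
  "((\<lambda>z. (z + 1) powr s / z powr s) \<longlongrightarrow> 1) (inf at_infinity (principal {z. 0 \<le> Re z}))"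
    (is "(_ \<longlongrightarrow> 1) ?H")
proof -
  have "((\<lambda>z::complex. 1 + inverse z) \<longlongrightarrow> 1 + 0) ?H"
    by (intro tendsto_add tendsto_const tendsto_mono[OF inf_le1 tendsto_inverse_0])
  then have "((\<lambda>z::complex. (1 + inverse z) powr s) \<longlongrightarrow> 1 powr s) ?H"
    by (intro tendsto_powr_complex) auto
  moreover have "\<forall>\<^sub>F z in ?H. (1 + inverse z) powr s = (z + 1) powr s / z powr s"
    unfolding eventually_inf_principal eventually_at_infinity
  proof (intro exI[of _ 1] allI impI)
    fix z :: complex assume "1 \<le> norm z" "z \<in> {z. 0 \<le> Re z}"
    then have z: "z \<noteq> 0" "0 \<le> Re z" by auto
    have Re: "0 < Re (1 + inverse z)" using z(2) by (simp add: add_pos_nonneg)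
    have nz: "1 + inverse z \<noteq> 0"
    proof
      assume "1 + inverse z = 0"
      then show False using Re by (simp only: zero_complex.sel)
    qed
    \<comment> \<open>Both numbers lie in the right half plane, so their arguments add up without crossing the branch cut.\<close>
    have "\<bar>Im (Ln z)\<bar> \<le> pi / 2" "\<bar>Im (Ln (1 + inverse z))\<bar> < pi / 2"
      using z Re nz Re_Ln_pos_le Re_Ln_pos_lt by blast+
    then have "Ln (z * (1 + inverse z)) = Ln z + Ln (1 + inverse z)"
      using z nz by (intro Ln_times_simple) auto
    moreover have "z * (1 + inverse z) = z + 1" using z by (simp add: algebra_simps)
    moreover have "z + 1 \<noteq> 0" using z by (auto simp: complex_eq_iff)
    ultimately show "(1 + inverse z) powr s = (z + 1) powr s / z powr s"
      using z nz by (simp add: powr_def exp_add algebra_simps)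
  qed
  ultimately show ?thesis unfolding powr_one_eq_one by (rule Lim_transform_eventually)
qed

text \<open>Without roots every point lies in the chamber, so the growth bound holds at \<open>p\<close> and at \<open>-p\<close>, which
  makes the quotient of both sides a bounded entire function.\<close>

lemma ray_no_roots:
  assumes E: "is_dunkl_kernel {} k E"
  shows "ray E y p z = exp (z * of_real (p \<bullet> y))"
proof -
  interpret positive_roots "{} :: (real ^ 'a) set" by unfold_locales auto
  define f where "f = (\<lambda>z. exp (- z * of_real (p \<bullet> y)) * ray E y p z)"
  have bound: "norm (ray E y p z) \<le> exp (Re z * (p \<bullet> y))" if "0 \<le> Re z" for p z
    using ray_bound[OF E, of p y z] that by (simp add: chamber_def)
  have "norm (f z) \<le> 1" for z
  proof -
    have "norm (ray E y p z) \<le> exp (Re z * (p \<bullet> y))"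
    proof (cases "0 \<le> Re z")
      case False
      have "z *s cvec p = (- z) *s cvec (- p)" by (simp add: vec_eq_iff cvec_def)
      then have "ray E y p z = ray E y (- p) (- z)" by (simp add: ray_def)
      then show ?thesis using bound[of "- z" "- p"] False by simp
    qed (rule bound)
    then have "norm (f z) \<le> exp (- (Re z * (p \<bullet> y))) * exp (Re z * (p \<bullet> y))"
      unfolding f_def norm_mult by (intro mult_mono) auto
    then show ?thesis by (simp add: exp_minus)
  qed
  moreover have "f holomorphic_on UNIV"
    unfolding f_def using E by (intro holomorphic_intros ray_holomorphic) (simp add: is_dunkl_kernel_def)
  ultimately have "f constant_on UNIV"
    by (intro Liouville_theorem) (auto simp: bounded_iff)
  then have "f z = f 0" by (auto simp: constant_on_def)
  then show ?thesis using ray_zero[OF E, of y p] by (simp add: f_def exp_minus field_simps)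
qed

section \<open>Passage to the half plane\<close>

text \<open>The case without roots is separated because \<open>x\<close> may then be \<open>0\<close>, where the ray through \<open>x\<close> carries
  no information; there the explicit exponential identifies \<open>v_e\<close> as \<open>1\<close>.\<close>

theorem theorem5p5:
  fixes R Rp :: "(real ^ 'n) set"
    and k :: "real ^ 'n \<Rightarrow> real"
    and E :: "complex ^ 'n \<Rightarrow> complex ^ 'n \<Rightarrow> complex"
    and v_e :: complex
    and x y :: "real ^ 'n"
  assumes "normalized_root_system R"
    and "positive_subsystem R Rp"
    and "nonneg_multiplicity R k"
    and "is_dunkl_kernel Rp k E"
    and "is_asymptotic_constant Rp k E v_e"
    and "x \<in> chamber Rp" and "y \<in> chamber Rp"
  shows "((\<lambda>z. z powr complex_of_real (gamma_index Rp k) * exp (- z * complex_of_real (x \<bullet> y)) *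
               E (z *s cvec x) (cvec y))
           \<longlongrightarrow> \<i> powr complex_of_real (gamma_index Rp k) * v_e /
                complex_of_real (sqrt (weight Rp k x * weight Rp k y)))
         (inf at_infinity (principal {z. 0 \<le> Re z}))"
proof (cases "Rp = {}")
  case True
  have kernel: "E (z *s cvec p) (cvec q) = exp (z * of_real (p \<bullet> q))" for z p q
    using ray_no_roots[of k E q p z] assms(4) by (simp add: True ray_def)
  have "((\<lambda>p. complex_of_real (sqrt (weight {} k p * weight {} k y)) *
      exp (- \<i> * complex_of_real (p \<bullet> y)) * E (\<i> *s cvec p) (cvec y)) \<longlongrightarrow> v_e)
      (inf at_infinity (principal (chamber_cone {} 1)))"
    using assms(5,7) zero_less_one unfolding is_asymptotic_constant_def True by blast
  moreover have "chamber_cone {} 1 = (UNIV :: (real ^ 'n) set)"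
    by (simp add: chamber_cone_def chamber_def)
  ultimately have "((\<lambda>p. 1) \<longlongrightarrow> v_e) (at_infinity :: (real ^ 'n) filter)"
    by (simp add: kernel weight_def exp_minus)
  then have v: "v_e = 1" by (intro tendsto_unique[OF trivial_limit_at_infinity _ tendsto_const])
  have "\<forall>\<^sub>F z in inf at_infinity (principal {z. 0 \<le> Re z}). z \<noteq> (0::complex)"
    unfolding eventually_inf_principal eventually_at_infinity by (intro exI[of _ 1]) auto
  then have "\<forall>\<^sub>F z in inf at_infinity (principal {z. 0 \<le> Re z}).
      z powr 0 * exp (- z * complex_of_real (x \<bullet> y)) * exp (z * complex_of_real (x \<bullet> y)) = 1"
    by eventually_elim (simp add: exp_minus)
  then show ?thesis
    unfolding True kernel v by (simp add: gamma_index_def weight_def tendsto_eventually)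
next
  case False
  interpret positive_roots Rp using assms by (rule_tac positive_roots_of_subsystem)
  have k: "0 \<le> k \<alpha>" if "\<alpha> \<in> Rp" for \<alpha>
    using assms(2,3) that by (auto simp: nonneg_multiplicity_def positive_subsystem_def)
  have hol: "holomorphic2 E" using assms(4) by (simp add: is_dunkl_kernel_def)
  have x0: "x \<noteq> 0" using assms(6) False by (auto simp: chamber_def)
  define \<gamma> where "\<gamma> = gamma_index Rp k"
  have \<gamma>: "0 \<le> \<gamma>" using k by (simp add: \<gamma>_def gamma_index_def sum_nonneg)
  define L where "L = \<i> powr of_real \<gamma> * v_e / of_real (sqrt (weight Rp k x * weight Rp k y))"
  define F where "F = (\<lambda>z. z powr of_real \<gamma> * exp (- z * of_real (x \<bullet> y)) * ray E y x z)"
  \<comment> \<open>Asymptotically equal to \<open>F\<close>, but holomorphic in a neighbourhood of the closed half plane.\<close>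
  define g where "g = (\<lambda>z. (z + 1) powr of_real \<gamma> * exp (- z * of_real (x \<bullet> y)) * ray E y x z)"
  define H where "H = inf at_infinity (principal {z. 0 \<le> Re z})"
  have F_axis: "((\<lambda>t. F (\<i> * of_real t)) \<longlongrightarrow> L) at_top"
    unfolding F_def L_def \<gamma>_def
    by (rule asymptotic_imaginary_axis[OF finite_roots assms(5,6) x0 assms(7)])
  have g_hol: "g holomorphic_on {z. 0 \<le> Re z}"
    unfolding g_def
    by (intro holomorphic_intros holomorphic_on_subset[OF ray_holomorphic[OF hol]])
      (auto simp: complex_nonpos_Reals_iff)
  have g_growth: "norm (g z) \<le> (1 + norm z) ^ nat \<lceil>\<gamma>\<rceil>" if "0 \<le> Re z" for z
  proof -
    have "norm (g z) = norm (z + 1) powr \<gamma> * (exp (- (Re z * (x \<bullet> y))) * norm (ray E y x z))"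
      by (simp add: g_def norm_mult norm_powr_real_powr' mult.assoc)
    also have "\<dots> \<le> norm (z + 1) powr \<gamma> * (exp (- (Re z * (x \<bullet> y))) * exp (Re z * (x \<bullet> y)))"
      using ray_bound[OF assms(4) k assms(6,7) that] by (intro mult_left_mono) auto
    also have "\<dots> = norm (z + 1) powr \<gamma>" by (simp add: exp_minus)
    also have "\<dots> \<le> (1 + norm z) powr \<gamma>"
      using norm_triangle_ineq[of z 1] \<gamma> by (intro powr_mono2) auto
    also have "\<dots> \<le> (1 + norm z) powr real (nat \<lceil>\<gamma>\<rceil>)"
      by (intro powr_mono real_nat_ceiling_ge) simp
    also have "\<dots> = (1 + norm z) ^ nat \<lceil>\<gamma>\<rceil>" by (rule powr_realpow) (simp add: add_pos_nonneg)
    finally show ?thesis .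
  qed
  have g_sym: "g (cnj z) = cnj (g z)" if "0 \<le> Re z" for z
    using that
    by (simp add: g_def ray_cnj[OF assms(4)] exp_cnj cnj_powr)
  have ratio: "((\<lambda>z. (z + 1) powr of_real \<gamma> / z powr of_real \<gamma>) \<longlongrightarrow> 1) H"
    unfolding H_def by (rule powr_shift_tendsto)
  have g_F: "g z = F z * ((z + 1) powr of_real \<gamma> / z powr of_real \<gamma>)" if "z \<noteq> 0" for z
    using that by (simp add: g_def F_def)
  have axis: "filterlim (\<lambda>t. \<i> * of_real t) H at_top"
    unfolding H_def filterlim_inf filterlim_principal
    by (auto intro!: tendsto_mult_filterlim_at_infinity[OF tendsto_const] filterlim_of_real_at_infinity)
  have "((\<lambda>t. F (\<i> * of_real t) * ((\<i> * of_real t + 1) powr of_real \<gamma> / (\<i> * of_real t) powr of_real \<gamma>))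
      \<longlongrightarrow> L * 1) at_top"
    by (intro tendsto_mult F_axis filterlim_compose[OF ratio axis])
  moreover have "\<forall>\<^sub>F t in at_top. F (\<i> * of_real t) * ((\<i> * of_real t + 1) powr of_real \<gamma> / (\<i> * of_real t) powr of_real \<gamma>)
      = g (\<i> * of_real t)"
    using eventually_gt_at_top[of 0] by eventually_elim (simp add: g_F)
  ultimately have g_axis: "((\<lambda>t. g (\<i> * of_real t)) \<longlongrightarrow> L) at_top"
    unfolding mult_1_right by (rule Lim_transform_eventually)
  have "(g \<longlongrightarrow> L) H"
    unfolding H_def
    by (rule symmetric_half_plane_tendsto[OF holomorphic_on_imp_continuous_on[OF g_hol]
          holomorphic_on_subset[OF g_hol] g_growth g_sym g_axis]) auto
  then have "((\<lambda>z. g z / ((z + 1) powr of_real \<gamma> / z powr of_real \<gamma>)) \<longlongrightarrow> L / 1) H"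
    by (intro tendsto_divide ratio) auto
  moreover have "\<forall>\<^sub>F z in H. g z / ((z + 1) powr of_real \<gamma> / z powr of_real \<gamma>) = F z"
    unfolding H_def eventually_inf_principal eventually_at_infinity
  proof (intro exI[of _ 1] allI impI)
    fix z :: complex assume "1 \<le> norm z" "z \<in> {z. 0 \<le> Re z}"
    then have "z \<noteq> 0" "0 \<le> Re z" by auto
    moreover from this have "z + 1 \<noteq> 0" by (auto simp: complex_eq_iff)
    ultimately show "g z / ((z + 1) powr of_real \<gamma> / z powr of_real \<gamma>) = F z" by (simp add: g_F)
  qed
  ultimately have "(F \<longlongrightarrow> L) H" unfolding div_by_1 by (rule Lim_transform_eventually)
  then show ?thesis by (simp add: F_def L_def H_def \<gamma>_def ray_def)
qed

end
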